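(* The Arveson space $\mathfrak A$ is, up to a multiplicative constant in the inner product, the unique reproducing kernel Hilbert space of $V_q$ power series such that $M_1,M_2,M_3$ are bounded operators there and satisfy $$I-\sum_{u=1}^3M_uM_u^*=C^*C.$$ Furthermore, in the Arveson space, $$M_u^*=B_u,\qquad u=1,2,3.$$
   Context: $\mathbb H$ denotes the quaternions. A point $x=(x_0,x_1,x_2,x_3)\in\mathbb R^4$ is identified with $q=x_0+\vec q$, where $\vec q=x_1\mathbf e_1+x_2\mathbf e_2+x_3\mathbf e_3$, and $\mathbb H^*=\{q:\vec q\neq0\}$. For $x\in\mathbb H^*$, $\mu_u(x)=x_u\left(1+\frac{x_0}{\vec q}\right)$, $u=1,2,3$, and $\mu^\alpha=\mu_1^{\alpha_1}\mu_2^{\alpha_2}\mu_3^{\alpha_3}$ for $\alpha\in\mathbb N_0^3$; $|\alpha|=\alpha_1+\alpha_2+\alpha_3$, $\alpha!=\alpha_1!\alpha_2!\alpha_3!$; $e_1=(1,0,0)$, $e_2=(0,1,0)$, $e_3=(0,0,1)$. A reproducing kernel Hilbert space of $V_q$ power series means a space $\mathfrak H(K_{\mathbf c})$ associated with positive weights $\mathbf c=(c_\alpha)_{\alpha\in\mathbb N_0^3}$: the right quaternionic Hilbert space of series $f=\sum_\alpha\mu^\alpha f_\alpha$ ($f_\alpha\in\mathbb H$) with $\sum_\alpha c_\alpha|f_\alpha|^2<\infty$, absolutely convergent in some set $\Omega_{r,R,\rho}=\{x\in\mathbb R^4: r<|x_u|<R,\ u=1,2,3,\ |x_0|<\rho\}$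 ($0<r<R$, $\rho>0$), with inner product $\langle f,g\rangle=\sum_\alpha c_\alpha\overline{g_\alpha}f_\alpha$ and reproducing kernel $\sum_\alpha\frac{\mu^\alpha(x)\overline{\mu^\alpha(y)}}{c_\alpha}$. The ($V_q$-)Arveson space $\mathfrak A$ is the case $c_\alpha=\frac{\alpha!}{|\alpha|!}$, with kernel $K_{\mathfrak A}(x,y)=\sum_\alpha\frac{|\alpha|!}{\alpha!}\mu^\alpha(x)\overline{\mu^\alpha(y)}$, its series being absolutely convergent on $\Omega_A=\{x\in\mathbb H^*:\sum_\alpha|\mu^\alpha(x)|^2\frac{|\alpha|!}{\alpha!}<\infty\}$. $M_u$ and $B_u$ are the right-linear operators determined by $M_u\mu^\alpha=\mu^{\alpha+e_u}$ and $B_u\mu^\alpha=\frac{\alpha_u}{|\alpha|}\mu^{\alpha-e_u}$ (with $B_u\mu^\alpha=0$ if $\alpha_u=0$). $C$ is the operator with values in $\mathbb H$ given by $C\left(\sum_\alpha\mu^\alpha f_\alpha\right)=f_{(0,0,0)}$. Adjoints are taken with respect to the inner product of the space under consideration and the inner product $\langle a,b\rangle=\overline b a$ on $\mathbb H$. *)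

theory Defs
  imports "HOL-Analysis.Analysis"
begin

text \<open>A quaternion is a real part together with a vector part in \<open>\<real>\<^sup>3\<close>; the unit
  \<open>e\<^sub>u\<close> is \<open>Quat 0 (axis u 1)\<close>.  Points of \<open>\<real>\<^sup>4\<close> are identified with quaternions throughout.\<close>

datatype quat = Quat (quat_re: real) (quat_vec: "real^3")

instantiation quat :: real_vector
begin

definition zero_quat :: quat where "0 = Quat 0 0"
definition plus_quat :: "quat \<Rightarrow> quat \<Rightarrow> quat" where
  "p + q = Quat (quat_re p + quat_re q) (quat_vec p + quat_vec q)"
definition uminus_quat :: "quat \<Rightarrow> quat" where
  "- q = Quat (- quat_re q) (- quat_vec q)"
definition minus_quat :: "quat \<Rightarrow> quat \<Rightarrow> quat" where
  "p - q = Quat (quat_re p - quat_re q) (quat_vec p - quat_vec q)"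
definition scaleR_quat :: "real \<Rightarrow> quat \<Rightarrow> quat" where
  "scaleR t q = Quat (t * quat_re q) (t *\<^sub>R quat_vec q)"

instance
  by standard (auto simp: zero_quat_def plus_quat_def uminus_quat_def minus_quat_def
      scaleR_quat_def algebra_simps)

end

lemma quat_sel_simps [simp]:
  "quat_re 0 = 0" "quat_vec 0 = 0"
  "quat_re (p + q) = quat_re p + quat_re q" "quat_vec (p + q) = quat_vec p + quat_vec q"
  "quat_re (p - q) = quat_re p - quat_re q" "quat_vec (p - q) = quat_vec p - quat_vec q"
  "quat_re (- q) = - quat_re q" "quat_vec (- q) = - quat_vec q"
  "quat_re (t *\<^sub>R q) = t * quat_re q" "quat_vec (t *\<^sub>R q) = t *\<^sub>R quat_vec q"
  by (simp_all add: zero_quat_def plus_quat_def minus_quat_def uminus_quat_def scaleR_quat_def)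

instantiation quat :: real_inner
begin

definition inner_quat :: "quat \<Rightarrow> quat \<Rightarrow> real" where
  "inner p q = quat_re p * quat_re q + inner (quat_vec p) (quat_vec q)"
definition norm_quat :: "quat \<Rightarrow> real" where
  "norm q = sqrt ((quat_re q)\<^sup>2 + (norm (quat_vec q))\<^sup>2)"
definition sgn_quat :: "quat \<Rightarrow> quat" where
  "sgn (q::quat) = q /\<^sub>R norm q"
definition dist_quat :: "quat \<Rightarrow> quat \<Rightarrow> real" where
  "dist (p::quat) q = norm (p - q)"
definition uniformity_quat :: "(quat \<times> quat) filter" where
  "(uniformity :: (quat \<times> quat) filter) = (INF e\<in>{0 <..}. principal {(p, q). dist p q < e})"
definition open_quat :: "quat set \<Rightarrow> bool" where
  "open (U :: quat set) \<longleftrightarrow> (\<forall>p\<in>U. eventually (\<lambda>(p', q). p' = p \<longrightarrow> q \<in> U) uniformity)"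

instance
proof
  fix p q r :: quat and t :: real and U :: "quat set"
  show "inner p p = 0 \<longleftrightarrow> p = 0"
    by (cases p) (auto simp: inner_quat_def zero_quat_def add_nonneg_eq_0_iff)
  show "norm p = sqrt (inner p p)"
    by (simp add: norm_quat_def inner_quat_def power2_norm_eq_inner power2_eq_square[of "quat_re p"])
qed (auto simp: inner_quat_def sgn_quat_def dist_quat_def uniformity_quat_def open_quat_def
    algebra_simps inner_commute)

end

definition quat_cnj :: "quat \<Rightarrow> quat" where
  "quat_cnj q = Quat (quat_re q) (- quat_vec q)"

lemma quat_vec_norm_sq: "(norm (v::real^3))\<^sup>2 = (v$1)\<^sup>2 + (v$2)\<^sup>2 + (v$3)\<^sup>2"
  unfolding power2_norm_eq_inner by (simp add: inner_vec_def sum_3 power2_eq_square)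

lemma quat_eqI: "quat_re p = quat_re q \<Longrightarrow> quat_vec p = quat_vec q \<Longrightarrow> p = q"
  by (rule quat.expand) simp

instantiation quat :: real_normed_div_algebra
begin

definition one_quat :: quat where "1 = Quat 1 0"
definition times_quat :: "quat \<Rightarrow> quat \<Rightarrow> quat" where
  "p * q = Quat (quat_re p * quat_re q - inner (quat_vec p) (quat_vec q))
     (quat_re p *\<^sub>R quat_vec q + quat_re q *\<^sub>R quat_vec p + cross3 (quat_vec p) (quat_vec q))"
definition inverse_quat :: "quat \<Rightarrow> quat" where
  "inverse q = quat_cnj q /\<^sub>R (norm q)\<^sup>2"
definition divide_quat :: "quat \<Rightarrow> quat \<Rightarrow> quat" where
  "(p::quat) div q = p * inverse q"

instance
proof
  fix p q r :: quat and t :: real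
  show "p * q * r = p * (q * r)"
    by (rule quat_eqI) (simp_all add: times_quat_def inner_vec_def sum_3 vec_eq_iff
        forall_3 cross3_def algebra_simps)
  show "(p + q) * r = p * r + q * r" "p * (q + r) = p * q + p * r"
    by (rule quat_eqI; simp add: times_quat_def algebra_simps
        cross_add_left cross_add_right)+
  show "1 * p = p" "p * 1 = p"
    by (rule quat_eqI; simp add: times_quat_def one_quat_def)+
  show "(0::quat) \<noteq> 1" by (simp add: zero_quat_def one_quat_def)
  show "t *\<^sub>R p * q = t *\<^sub>R (p * q)" "p * t *\<^sub>R q = t *\<^sub>R (p * q)"
    by (rule quat_eqI; simp add: times_quat_def algebra_simps cross_mult_left cross_mult_right)+
  have nrm: "(norm q)\<^sup>2 = (quat_re q)\<^sup>2 + inner (quat_vec q) (quat_vec q)" for q :: quat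
    by (simp add: norm_quat_def power2_norm_eq_inner)
  have r: "p * quat_cnj p = (norm p)\<^sup>2 *\<^sub>R 1" "quat_cnj p * p = (norm p)\<^sup>2 *\<^sub>R 1" for p :: quat
    by (rule quat_eqI; simp add: times_quat_def one_quat_def quat_cnj_def
        nrm[unfolded power2_eq_square] power2_eq_square)+
  have sc: "p * t *\<^sub>R q = t *\<^sub>R (p * q)" "t *\<^sub>R p * q = t *\<^sub>R (p * q)" for p q :: quat and t
    by (rule quat_eqI; simp add: times_quat_def algebra_simps cross_mult_left cross_mult_right)+
  show "p \<noteq> 0 \<Longrightarrow> inverse p * p = 1" "p \<noteq> 0 \<Longrightarrow> p * inverse p = 1"
    by (simp_all add: inverse_quat_def sc r)
  show "p div q = p * inverse q" by (simp add: divide_quat_def)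
  show "inverse (0::quat) = 0"
    by (rule quat_eqI) (simp_all add: inverse_quat_def quat_cnj_def)
  have "(norm (p * q))\<^sup>2 = (norm p)\<^sup>2 * (norm q)\<^sup>2"
    unfolding nrm by (simp add: times_quat_def inner_vec_def sum_3 cross3_def) algebra
  then have "(norm (p * q))\<^sup>2 = (norm p * norm q)\<^sup>2"
    by (simp add: power_mult_distrib)
  then show "norm (p * q) = norm p * norm q"
    by simp
qed

end

instance quat :: banach
proof
  fix X :: "nat \<Rightarrow> quat"
  assume "Cauchy X"
  have b: "bounded_linear quat_re" "bounded_linear quat_vec"
    by (unfold_locales; (simp; fail)?;
        rule exI[of _ 1]; simp add: norm_quat_def real_le_rsqrt)+
  obtain a v where l: "(\<lambda>n. quat_re (X n)) \<longlonglongrightarrow> a" "(\<lambda>n. quat_vec (X n)) \<longlonglongrightarrow> v"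
    using b[THEN bounded_linear.Cauchy, OF \<open>Cauchy X\<close>]
    by (auto simp: Cauchy_convergent_iff convergent_def)
  have "(\<lambda>n. sqrt ((quat_re (X n) - a)\<^sup>2 + (norm (quat_vec (X n) - v))\<^sup>2)) \<longlonglongrightarrow>
      sqrt ((a - a)\<^sup>2 + (norm (v - v))\<^sup>2)"
    by (intro tendsto_intros l)
  then have "X \<longlonglongrightarrow> Quat a v"
    by (simp add: tendsto_dist_iff[of X] dist_quat_def norm_quat_def)
  then show "convergent X" by (auto simp: convergent_def)
qed

definition Hstar :: "quat set" where
  "Hstar = {q. quat_vec q \<noteq> 0}"

definition Vq_mu :: "3 \<Rightarrow> quat \<Rightarrow> quat" where
  "Vq_mu u x = of_real (quat_vec x $ u) * (1 + of_real (quat_re x) / Quat 0 (quat_vec x))"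

definition Vq_mu_pow :: "nat^3 \<Rightarrow> quat \<Rightarrow> quat" where
  "Vq_mu_pow \<alpha> x = Vq_mu 1 x ^ (\<alpha> $ 1) * Vq_mu 2 x ^ (\<alpha> $ 2) * Vq_mu 3 x ^ (\<alpha> $ 3)"

definition midx_abs :: "nat^3 \<Rightarrow> nat" where
  "midx_abs \<alpha> = \<alpha> $ 1 + \<alpha> $ 2 + \<alpha> $ 3"

definition midx_fact :: "nat^3 \<Rightarrow> nat" where
  "midx_fact \<alpha> = fact (\<alpha> $ 1) * fact (\<alpha> $ 2) * fact (\<alpha> $ 3)"

definition Vq_Omega :: "real \<Rightarrow> real \<Rightarrow> real \<Rightarrow> quat set" where
  "Vq_Omega r R \<rho> = {x. (\<forall>u. r < \<bar>quat_vec x $ u\<bar> \<and> \<bar>quat_vec x $ u\<bar> < R) \<and> \<bar>quat_re x\<bar> < \<rho>}"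

text \<open>A function on a domain \<open>\<Omega>\<close> is represented by its extension by \<open>0\<close>.\<close>

definition zero_ext :: "quat set \<Rightarrow> (quat \<Rightarrow> quat) \<Rightarrow> quat \<Rightarrow> quat" where
  "zero_ext \<Omega> f = (\<lambda>x. if x \<in> \<Omega> then f x else 0)"

definition Vq_abs_conv :: "quat set \<Rightarrow> (nat^3 \<Rightarrow> quat) \<Rightarrow> bool" where
  "Vq_abs_conv \<Omega> a \<longleftrightarrow> (\<forall>x\<in>\<Omega>. (\<lambda>\<alpha>. norm (Vq_mu_pow \<alpha> x * a \<alpha>)) summable_on UNIV)"

definition Vq_series :: "quat set \<Rightarrow> (nat^3 \<Rightarrow> quat) \<Rightarrow> quat \<Rightarrow> quat" where
  "Vq_series \<Omega> a = zero_ext \<Omega> (\<lambda>x. \<Sum>\<^sub>\<infinity>\<alpha>. Vq_mu_pow \<alpha> x * a \<alpha>)"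

text \<open>The coefficients of the absolutely convergent expansion of \<open>f\<close> on \<open>\<Omega>\<close>.  They are unique
  as soon as \<open>\<Omega>\<close> contains some \<^term>\<open>Vq_Omega r R \<rho>\<close> with \<open>0 < r < R\<close> and \<open>0 < \<rho>\<close>, because
  \<open>\<mu>\<^sup>\<alpha>\<close> is the ordinary real monomial where \<open>x\<^sub>0 = 0\<close>.\<close>

definition Vq_coeff :: "quat set \<Rightarrow> (quat \<Rightarrow> quat) \<Rightarrow> nat^3 \<Rightarrow> quat" where
  "Vq_coeff \<Omega> f = (THE a. Vq_abs_conv \<Omega> a \<and> f = Vq_series \<Omega> a)"

definition Vq_coeff_space :: "(nat^3 \<Rightarrow> real) \<Rightarrow> (nat^3 \<Rightarrow> quat) set" where
  "Vq_coeff_space c = {a. (\<lambda>\<alpha>. c \<alpha> * (norm (a \<alpha>))\<^sup>2) summable_on UNIV}"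

definition Vq_space :: "(nat^3 \<Rightarrow> real) \<Rightarrow> quat set \<Rightarrow> (quat \<Rightarrow> quat) set" where
  "Vq_space c \<Omega> = Vq_series \<Omega> ` Vq_coeff_space c"

definition Vq_inner ::
    "(nat^3 \<Rightarrow> real) \<Rightarrow> quat set \<Rightarrow> (quat \<Rightarrow> quat) \<Rightarrow> (quat \<Rightarrow> quat) \<Rightarrow> quat" where
  "Vq_inner c \<Omega> f g = (\<Sum>\<^sub>\<infinity>\<alpha>. c \<alpha> *\<^sub>R (quat_cnj (Vq_coeff \<Omega> g \<alpha>) * Vq_coeff \<Omega> f \<alpha>))"

definition Vq_norm :: "(nat^3 \<Rightarrow> real) \<Rightarrow> quat set \<Rightarrow> (quat \<Rightarrow> quat) \<Rightarrow> real" where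
  "Vq_norm c \<Omega> f = sqrt (quat_re (Vq_inner c \<Omega> f f))"

definition Vq_kernel :: "(nat^3 \<Rightarrow> real) \<Rightarrow> quat \<Rightarrow> quat \<Rightarrow> quat" where
  "Vq_kernel c x y = (\<Sum>\<^sub>\<infinity>\<alpha>. (Vq_mu_pow \<alpha> x * quat_cnj (Vq_mu_pow \<alpha> y)) /\<^sub>R c \<alpha>)"

text \<open>The domain need not equal some \<^term>\<open>Vq_Omega r R \<rho>\<close>, only contain one, so that the
  Arveson space on its natural domain is covered as well.\<close>

definition Vq_rkhs :: "(nat^3 \<Rightarrow> real) \<Rightarrow> quat set \<Rightarrow> bool" where
  "Vq_rkhs c \<Omega> \<longleftrightarrow>
     (\<forall>\<alpha>. c \<alpha> > 0) \<and>
     \<Omega> \<subseteq> Hstar \<and>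
     (\<exists>r R \<rho>. 0 < r \<and> r < R \<and> 0 < \<rho> \<and> Vq_Omega r R \<rho> \<subseteq> \<Omega>) \<and>
     (\<forall>a\<in>Vq_coeff_space c. Vq_abs_conv \<Omega> a) \<and>
     (\<forall>y\<in>\<Omega>. zero_ext \<Omega> (\<lambda>x. Vq_kernel c x y) \<in> Vq_space c \<Omega> \<and>
        (\<forall>f\<in>Vq_space c \<Omega>. Vq_inner c \<Omega> f (zero_ext \<Omega> (\<lambda>x. Vq_kernel c x y)) = f y))"

definition Vq_bounded_op ::
    "(nat^3 \<Rightarrow> real) \<Rightarrow> quat set \<Rightarrow> ((quat \<Rightarrow> quat) \<Rightarrow> quat \<Rightarrow> quat) \<Rightarrow> bool" where
  "Vq_bounded_op c \<Omega> T \<longleftrightarrow>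
     (\<forall>f\<in>Vq_space c \<Omega>. T f \<in> Vq_space c \<Omega>) \<and>
     (\<forall>f\<in>Vq_space c \<Omega>. \<forall>g\<in>Vq_space c \<Omega>. T (\<lambda>x. f x + g x) = (\<lambda>x. T f x + T g x)) \<and>
     (\<forall>f\<in>Vq_space c \<Omega>. \<forall>a. T (\<lambda>x. f x * a) = (\<lambda>x. T f x * a)) \<and>
     (\<exists>B. \<forall>f\<in>Vq_space c \<Omega>. Vq_norm c \<Omega> (T f) \<le> B * Vq_norm c \<Omega> f)"

text \<open>The right-linear operator determined by the images \<open>b \<alpha>\<close> of the monomials \<open>\<mu>\<^sup>\<alpha>\<close>:
  \<open>\<Sum>\<^sub>\<alpha> \<mu>\<^sup>\<alpha> f\<^sub>\<alpha> \<mapsto> \<Sum>\<^sub>\<alpha> (b \<alpha>) f\<^sub>\<alpha>\<close>.\<close>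

definition Vq_op ::
    "quat set \<Rightarrow> (nat^3 \<Rightarrow> quat \<Rightarrow> quat) \<Rightarrow> (quat \<Rightarrow> quat) \<Rightarrow> quat \<Rightarrow> quat" where
  "Vq_op \<Omega> b f = zero_ext \<Omega> (\<lambda>x. \<Sum>\<^sub>\<infinity>\<alpha>. b \<alpha> x * Vq_coeff \<Omega> f \<alpha>)"

definition Vq_M :: "quat set \<Rightarrow> 3 \<Rightarrow> (quat \<Rightarrow> quat) \<Rightarrow> quat \<Rightarrow> quat" where
  "Vq_M \<Omega> u = Vq_op \<Omega> (\<lambda>\<alpha>. Vq_mu_pow (\<alpha> + axis u 1))"

definition Vq_B :: "quat set \<Rightarrow> 3 \<Rightarrow> (quat \<Rightarrow> quat) \<Rightarrow> quat \<Rightarrow> quat" where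
  "Vq_B \<Omega> u = Vq_op \<Omega> (\<lambda>\<alpha> x. if \<alpha> $ u = 0 then 0
     else (real (\<alpha> $ u) / real (midx_abs \<alpha>)) *\<^sub>R Vq_mu_pow (\<alpha> - axis u 1) x)"

definition Vq_C :: "quat set \<Rightarrow> (quat \<Rightarrow> quat) \<Rightarrow> quat" where
  "Vq_C \<Omega> f = Vq_coeff \<Omega> f 0"

definition quat_ip :: "quat \<Rightarrow> quat \<Rightarrow> quat" where
  "quat_ip a b = quat_cnj b * a"

text \<open>The adjoint of \<open>T : V \<rightarrow> W\<close> with respect to inner products \<open>ipV\<close> on \<open>V\<close> and \<open>ipW\<close> on
  \<open>W\<close>; it is meaningful for bounded \<open>T\<close> between Hilbert spaces, where \<open>h\<close> exists by the
  Riesz representation theorem.\<close>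

definition adjoint_op ::
    "'v set \<Rightarrow> ('v \<Rightarrow> 'v \<Rightarrow> quat) \<Rightarrow> ('w \<Rightarrow> 'w \<Rightarrow> quat) \<Rightarrow> ('v \<Rightarrow> 'w) \<Rightarrow> 'w \<Rightarrow> 'v" where
  "adjoint_op V ipV ipW T g = (THE h. h \<in> V \<and> (\<forall>f\<in>V. ipW (T f) g = ipV f h))"

definition Vq_M_adj ::
    "(nat^3 \<Rightarrow> real) \<Rightarrow> quat set \<Rightarrow> 3 \<Rightarrow> (quat \<Rightarrow> quat) \<Rightarrow> quat \<Rightarrow> quat" where
  "Vq_M_adj c \<Omega> u = adjoint_op (Vq_space c \<Omega>) (Vq_inner c \<Omega>) (Vq_inner c \<Omega>) (Vq_M \<Omega> u)"

definition Vq_C_adj :: "(nat^3 \<Rightarrow> real) \<Rightarrow> quat set \<Rightarrow> quat \<Rightarrow> quat \<Rightarrow> quat" where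
  "Vq_C_adj c \<Omega> = adjoint_op (Vq_space c \<Omega>) (Vq_inner c \<Omega>) quat_ip (Vq_C \<Omega>)"

definition Vq_structural_identity :: "(nat^3 \<Rightarrow> real) \<Rightarrow> quat set \<Rightarrow> bool" where
  "Vq_structural_identity c \<Omega> \<longleftrightarrow>
     (\<forall>f\<in>Vq_space c \<Omega>.
        (\<lambda>x. f x - (\<Sum>u\<in>UNIV. Vq_M \<Omega> u (Vq_M_adj c \<Omega> u f) x)) = Vq_C_adj c \<Omega> (Vq_C \<Omega> f))"

definition arveson_weight :: "nat^3 \<Rightarrow> real" where
  "arveson_weight \<alpha> = real (midx_fact \<alpha>) / fact (midx_abs \<alpha>)"

definition Omega_A :: "quat set" where
  "Omega_A = {x\<in>Hstar.
     (\<lambda>\<alpha>. (norm (Vq_mu_pow \<alpha> x))\<^sup>2 * (fact (midx_abs \<alpha>) / real (midx_fact \<alpha>))) summable_on UNIV}"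

abbreviation arveson_space :: "(quat \<Rightarrow> quat) set" where
  "arveson_space \<equiv> Vq_space arveson_weight Omega_A"

abbreviation arveson_inner :: "(quat \<Rightarrow> quat) \<Rightarrow> (quat \<Rightarrow> quat) \<Rightarrow> quat" where
  "arveson_inner \<equiv> Vq_inner arveson_weight Omega_A"

end

theory Submission
  imports Defs "HOL-Complex_Analysis.Conformal_Mappings"
begin

text \<open>Where \<open>x\<^sub>0 = 0\<close> a series \<open>\<Sum>\<^sub>\<alpha> \<mu>\<^sup>\<alpha> f\<^sub>\<alpha>\<close> is a real power series in three variables, so its
  coefficients are unique and every space in question is a weighted \<open>\<ell>\<^sup>2\<close> space of coefficients.
  There \<open>M\<^sub>u\<close> is a shift, and its adjoint sends \<open>(f\<^sub>\<alpha>)\<close> to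
  \<open>(c\<^bsub>\<alpha>+e\<^sub>u\<^esub> / c\<^sub>\<alpha> \<cdot> f\<^bsub>\<alpha>+e\<^sub>u\<^esub>)\<close>.  Both sides of the structural identity are thus diagonal, and
  comparing coefficients turns it into \<open>c\<^sub>0 = 1\<close> and
  \<open>1 / c\<^sub>\<alpha> = \<Sum>\<^sub>u 1 / c\<^bsub>\<alpha>-e\<^sub>u\<^esub>\<close> (over \<open>u\<close> with \<open>\<alpha>\<^sub>u > 0\<close>), the recurrence of the multinomial
  coefficients.  In particular the multiplicative constant is always 1.\<close>

text \<open>Keeps the 1 in \<open>axis u 1\<close> from turning into \<open>Suc 0\<close>, so that
  the shift rules below match.\<close>

declare One_nat_def [simp del]

subsection \<open>Uniqueness of coefficients\<close>

text \<open>Convergence at real points arbitrarily near R gives a holomorphic sum on the complex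
  disc of radius R. It vanishes on a real interval, hence on the whole disc by analytic
  continuation, whereas a nonzero coefficient would make 0 an isolated zero.\<close>

lemma powser_zero_on_interval:
  fixes b :: "nat \<Rightarrow> real"
  assumes "0 \<le> r" "r < R" and zero: "\<And>t. r < t \<Longrightarrow> t < R \<Longrightarrow> (\<lambda>n. t ^ n * b n) sums 0"
  shows "b n = 0"
proof -
  define F where "F z = (\<Sum>n. complex_of_real (b n) * z ^ n)" for z
  have sums: "(\<lambda>n. complex_of_real (b n) * z ^ n) sums F z" if z: "norm z < R" for z
  proof -
    obtain t where t: "max r (norm z) < t" "t < R"
      using dense[of "max r (norm z)" R] z assms(2) by auto
    have "summable (\<lambda>n. b n * t ^ n)"
      using sums_summable[OF zero[of t]] t by (simp add: mult.commute)
    then have "summable (\<lambda>n. complex_of_real (b n) * of_real t ^ n)"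
      using summable_of_real[of "\<lambda>n. b n * t ^ n"] by simp
    then have "summable (\<lambda>n. complex_of_real (b n) * z ^ n)"
      by (rule powser_inside) (use t in auto)
    then show ?thesis unfolding F_def by (rule summable_sums)
  qed
  have hol: "F holomorphic_on ball 0 R"
    by (rule power_series_holomorphic[where a = "\<lambda>n. complex_of_real (b n)"]) (use sums in auto)
  define m where "m = (r + R) / 2"
  define U where "U = complex_of_real ` {r<..<R}"
  have m: "r < m" "m < R" using assms by (auto simp: m_def)
  have F_U: "F z = 0" if z: "z \<in> U" for z
  proof -
    obtain t where t: "z = of_real t" "r < t" "t < R" using z by (auto simp: U_def)
    have "(\<lambda>n. complex_of_real (t ^ n * b n)) sums of_real 0"
      using zero[OF t(2,3)] by (subst sums_of_real_iff)
    then have "(\<lambda>n. complex_of_real (b n) * z ^ n) sums 0" by (simp add: t(1) mult.commute)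
    moreover have "(\<lambda>n. complex_of_real (b n) * z ^ n) sums F z"
      using sums t assms(1) by simp
    ultimately show ?thesis using sums_unique2 by blast
  qed
  have "of_real m islimpt U"
    unfolding islimpt_approachable
  proof (intro allI impI)
    fix e :: real assume "e > 0"
    then obtain t where t: "m < t" "t < min R (m + e)" using m dense[of m "min R (m + e)"] by auto
    have "dist (complex_of_real t) (of_real m) = \<bar>t - m\<bar>" by (simp add: dist_real_def)
    then show "\<exists>x'\<in>U. x' \<noteq> complex_of_real m \<and> dist x' (complex_of_real m) < e"
      using t m by (intro bexI[of _ "of_real t"]) (auto simp: U_def)
  qed
  have F0: "F w = 0" if "norm w < R" for w
  proof (rule analytic_continuation[OF hol])
    show "U \<subseteq> ball 0 R" using assms(1) by (auto simp: U_def)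
    show "complex_of_real m \<in> ball 0 R" using assms(1) m by simp
  qed (use \<open>of_real m islimpt U\<close> F_U that in auto)
  \<comment> \<open>The constant term is read off at 0 separately, since
    \<open>powser_0_nonzero\<close> is applied below with \<open>F 0 = 0\<close> and a positive
    index.\<close>
  have "b 0 = 0"
    using sums_unique2[OF powser_sums_zero[of "\<lambda>n. complex_of_real (b n)"], of "F 0"] sums[of 0] F0[of 0] assms(1,2)
    by simp
  moreover have "b n = 0" if "n > 0"
  proof (rule ccontr)
    assume nz: "b n \<noteq> 0"
    have "0 < R" "\<And>z. norm (z - 0) < R \<Longrightarrow> (\<lambda>n. complex_of_real (b n) * (z - 0) ^ n) sums F z"
        "F 0 = 0" "complex_of_real (b n) \<noteq> 0"
      using assms(1,2) sums F0[of 0] nz by auto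
    from powser_0_nonzero[OF this that]
    obtain s where s: "0 < s" "\<And>z. z \<in> cball 0 s - {0} \<Longrightarrow> F z \<noteq> 0"
      by metis
    define t where "t = min s (m)"
    have "F (of_real t) \<noteq> 0" using s m assms(1) by (intro s(2)) (auto simp: t_def)
    moreover have "F (of_real t) = 0" using s m assms(1) by (intro F0) (auto simp: t_def)
    ultimately show False by simp
  qed
  ultimately show ?thesis by (cases "n = 0") auto
qed

text \<open>Summing over j first leaves a power series in t whose n-th coefficient is the sum of
  \<open>g (n, j)\<close> over j. This peels off one variable of a multiple series at a
  time.\<close>

lemma powser_zero_on_interval_fibrewise:
  fixes g :: "nat \<times> 'b \<Rightarrow> real"
  assumes "0 \<le> r" "r < R"
    and zero: "\<And>t. r < t \<Longrightarrow> t < R \<Longrightarrow> ((\<lambda>(n, j). t ^ n * g (n, j)) has_sum 0) UNIV"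
  shows "((\<lambda>j. g (n, j)) has_sum 0) UNIV"
proof -
  have sm: "(\<lambda>j. g (n, j)) summable_on UNIV" for n
  proof -
    \<comment> \<open>Any such t is positive, so \<open>t ^ n\<close> can be divided out.\<close>
    obtain t where t: "r < t" "t < R" using dense assms(2) by blast
    have "(\<lambda>(n, j). t ^ n * g (n, j)) summable_on UNIV \<times> UNIV"
      using zero[OF t] by (simp add: has_sum_imp_summable)
    from summable_on_SigmaD1[OF this, of n]
    have "(\<lambda>j. t ^ n * g (n, j)) summable_on UNIV" by simp
    then have "(\<lambda>j. (1 / t ^ n) * (t ^ n * g (n, j))) summable_on UNIV"
      by (rule summable_on_cmult_right)
    then show ?thesis using t assms(1) by simp
  qed
  have "(\<Sum>\<^sub>\<infinity>j. g (n, j)) = 0" for n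
  proof (rule powser_zero_on_interval[OF assms(1,2)])
    fix t assume t: "r < t" "t < R"
    have "((\<lambda>n. t ^ n * (\<Sum>\<^sub>\<infinity>j. g (n, j))) has_sum 0) UNIV"
    proof (rule has_sum_SigmaD[where B = "\<lambda>_. UNIV" and f = "\<lambda>(n, j). t ^ n * g (n, j)"])
      show "((\<lambda>(n, j). t ^ n * g (n, j)) has_sum 0) (UNIV \<times> UNIV)" using zero[OF t] by simp
    qed (use sm in \<open>auto intro!: has_sum_cmult_right has_sum_infsum\<close>)
    then show "(\<lambda>n. t ^ n * (\<Sum>\<^sub>\<infinity>j. g (n, j))) sums 0" by (rule has_sum_imp_sums)
  qed
  then show ?thesis using sm has_sum_infsum by metis
qed

text \<open>Turns sums over \<open>nat^3\<close> into sums over nested pairs, to which the rules for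
  iterated sums apply.\<close>

lemma bij_vector_triple: "bij_betw (\<lambda>(i, j, k). vector [i, j, k] :: 'a::zero^3) UNIV UNIV"
  by (rule bij_betw_byWitness[where f' = "\<lambda>\<alpha>. (\<alpha> $ 1, \<alpha> $ 2, \<alpha> $ 3)"])
    (auto simp: vec_eq_iff forall_3)

text \<open>The fibrewise lemma removes the first variable and then the second, each time with the
  remaining ones held fixed; the one-variable lemma removes the third.\<close>

lemma power3_series_zero:
  fixes a :: "nat^3 \<Rightarrow> real"
  assumes "0 \<le> r" "r < R"
    and zero: "\<And>v :: real^3. (\<forall>u. r < v $ u \<and> v $ u < R) \<Longrightarrow>
      ((\<lambda>\<alpha>. v $ 1 ^ (\<alpha> $ 1) * v $ 2 ^ (\<alpha> $ 2) * v $ 3 ^ (\<alpha> $ 3) * a \<alpha>) has_sum 0) UNIV"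
  shows "a \<alpha> = 0"
proof -
  define b where "b i j k = a (vector [i, j, k])" for i j k
  have z: "((\<lambda>(i, j, k). x ^ i * (y ^ j * (z ^ k * b i j k))) has_sum 0) UNIV"
    if "r < x" "x < R" "r < y" "y < R" "r < z" "z < R" for x y z
  proof -
    have "((\<lambda>\<alpha>. x ^ (\<alpha> $ 1) * y ^ (\<alpha> $ 2) * z ^ (\<alpha> $ 3) * a \<alpha>) has_sum 0) UNIV"
      using zero[of "vector [x, y, z]"] that by (simp add: forall_3)
    then have "((\<lambda>p. (\<lambda>\<alpha>. x ^ (\<alpha> $ 1) * y ^ (\<alpha> $ 2) * z ^ (\<alpha> $ 3) * a \<alpha>)
        (case p of (i, j, k) \<Rightarrow> vector [i, j, k])) has_sum 0) UNIV"
      by (subst has_sum_reindex_bij_betw[OF bij_vector_triple])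
    then show ?thesis by (simp add: case_prod_unfold b_def mult.assoc)
  qed
  have z1: "((\<lambda>(j, k). y ^ j * (z ^ k * b i j k)) has_sum 0) UNIV"
    if "r < y" "y < R" "r < z" "z < R" for i y z
    using powser_zero_on_interval_fibrewise[OF assms(1,2),
        of "\<lambda>(i, j, k). y ^ j * (z ^ k * b i j k)" i] z that
    by (simp add: case_prod_unfold)
  have z2: "((\<lambda>k. z ^ k * b i j k) has_sum 0) UNIV" if "r < z" "z < R" for i j z
    using powser_zero_on_interval_fibrewise[OF assms(1,2),
        of "\<lambda>(j, k). z ^ k * b i j k" j] z1 that
    by (simp add: case_prod_unfold)
  have "b i j k = 0" for i j k
    using powser_zero_on_interval[OF assms(1,2)] z2 has_sum_imp_sums by blast
  moreover have "\<alpha> = vector [\<alpha> $ 1, \<alpha> $ 2, \<alpha> $ 3]" by (simp add: vec_eq_iff forall_3)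
  ultimately show ?thesis unfolding b_def by metis
qed

text \<open>At points with zero real part and coordinates in (r, R) every \<mu>^\<alpha> is a real
  monomial. Pairing the quaternion coefficients with a fixed vector then leaves a real power series
  in three variables that vanishes on a cube.\<close>

lemma Vq_series_injective:
  assumes "Vq_abs_conv \<Omega> a" "Vq_abs_conv \<Omega> b" "Vq_series \<Omega> a = Vq_series \<Omega> b"
    "0 < r" "r < R" "0 < \<rho>" "Vq_Omega r R \<rho> \<subseteq> \<Omega>"
  shows "a = b"
proof
  fix \<alpha>
  have "norm (a \<alpha> - b \<alpha>) ^ 2 = 0"
  proof -
    \<comment> \<open>Pairing with the difference at the index \<alpha> itself makes the \<alpha>-th
      coefficient its squared norm.\<close>
    define w where "w = a \<alpha> - b \<alpha>"
    have "(a \<alpha> - b \<alpha>) \<bullet> w = 0"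
    proof (rule power3_series_zero[of r R "\<lambda>\<beta>. (a \<beta> - b \<beta>) \<bullet> w"])
      fix v :: "real^3" assume v: "\<forall>u. r < v $ u \<and> v $ u < R"
      define x where "x = Quat 0 v"
      define p where "p \<beta> = v $ 1 ^ (\<beta> $ 1) * v $ 2 ^ (\<beta> $ 2) * v $ 3 ^ (\<beta> $ 3)" for \<beta> :: "nat^3"
      have x: "x \<in> \<Omega>"
      proof -
        have "r < \<bar>v $ u\<bar> \<and> \<bar>v $ u\<bar> < R" for u using v[rule_format, of u] assms(4) by linarith
        then have "x \<in> Vq_Omega r R \<rho>" using assms(6) by (auto simp: x_def Vq_Omega_def)
        then show ?thesis using assms(7) by blast
      qed
      have mu: "Vq_mu_pow \<beta> x = of_real (p \<beta>)" for \<beta>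
        by (simp add: Vq_mu_pow_def Vq_mu_def x_def p_def)
      have *: "(\<lambda>\<beta>. Vq_mu_pow \<beta> x * d \<beta>) summable_on UNIV" if "Vq_abs_conv \<Omega> d" for d
        using that x unfolding Vq_abs_conv_def by (blast intro: abs_summable_summable)
      have "(\<Sum>\<^sub>\<infinity>\<beta>. Vq_mu_pow \<beta> x * a \<beta>) = (\<Sum>\<^sub>\<infinity>\<beta>. Vq_mu_pow \<beta> x * b \<beta>)"
        using fun_cong[OF assms(3), of x] x by (simp add: Vq_series_def zero_ext_def)
      then have "((\<lambda>\<beta>. Vq_mu_pow \<beta> x * a \<beta> + - (Vq_mu_pow \<beta> x * b \<beta>)) has_sum 0) UNIV"
        using has_sum_add[OF has_sum_infsum[OF *[OF assms(1)]]
            has_sum_uminusI[OF has_sum_infsum[OF *[OF assms(2)]]]] by simp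
      then have "((\<lambda>\<beta>. (Vq_mu_pow \<beta> x * a \<beta> + - (Vq_mu_pow \<beta> x * b \<beta>)) \<bullet> w) has_sum 0 \<bullet> w) UNIV"
        by (rule has_sum_bounded_linear[OF bounded_linear_inner_left])
      moreover have "(Vq_mu_pow \<beta> x * a \<beta> + - (Vq_mu_pow \<beta> x * b \<beta>)) \<bullet> w = p \<beta> * ((a \<beta> - b \<beta>) \<bullet> w)" for \<beta>
        by (simp add: mu scaleR_conv_of_real[symmetric] inner_diff_left algebra_simps)
      ultimately show "((\<lambda>\<beta>. v $ 1 ^ (\<beta> $ 1) * v $ 2 ^ (\<beta> $ 2) * v $ 3 ^ (\<beta> $ 3) *
          ((a \<beta> - b \<beta>) \<bullet> w)) has_sum 0) UNIV"
        by (simp add: p_def)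
    qed (use assms in auto)
    then show ?thesis by (simp add: w_def power2_norm_eq_inner)
  qed
  then show "a \<alpha> = b \<alpha>" by simp
qed

text \<open>Injectivity makes the definite description in \<open>Vq_coeff\<close> well
  defined.\<close>

lemma Vq_coeff_series:
  assumes "Vq_abs_conv \<Omega> a" "0 < r" "r < R" "0 < \<rho>" "Vq_Omega r R \<rho> \<subseteq> \<Omega>"
  shows "Vq_coeff \<Omega> (Vq_series \<Omega> a) = a"
  unfolding Vq_coeff_def
proof (rule the_equality)
  fix b assume "Vq_abs_conv \<Omega> b \<and> Vq_series \<Omega> a = Vq_series \<Omega> b"
  then show "b = a" using Vq_series_injective[OF assms(1) _ _ assms(2-5)] by blast
qed (use assms(1) in simp)

subsection \<open>Weighted coefficient spaces\<close>

lemma quat_cnj_simps [simp]: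
  "quat_cnj (quat_cnj q) = q" "norm (quat_cnj q) = norm q" "quat_cnj 0 = 0" "quat_cnj 1 = 1"
  "quat_cnj (t *\<^sub>R q) = t *\<^sub>R quat_cnj q" "quat_cnj (p * q) = quat_cnj q * quat_cnj p"
  by (auto intro!: quat_eqI simp: quat_cnj_def norm_quat_def one_quat_def times_quat_def cross_minus_left
    cross_minus_right cross_skew[of "quat_vec q"] inner_commute)

lemma quat_cnj_mult_self: "quat_cnj q * q = of_real ((norm q)\<^sup>2)"
  unfolding of_real_def
  by (rule quat_eqI) (simp_all add: quat_cnj_def times_quat_def one_quat_def norm_quat_def
    dot_square_norm power2_eq_square[of "quat_re q"])

lemma quat_cnj_inject [simp]: "quat_cnj p = quat_cnj q \<longleftrightarrow> p = q"
  by (metis quat_cnj_simps(1))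

section \<open>Reindexing by unit shifts, and elementary sum estimates\<close>

lemma inj_add_axis: "inj_on (\<lambda>\<alpha> :: nat^'n. \<alpha> + axis u 1) A"
  by (auto simp: inj_on_def)

lemma diff_axis_add: "(\<alpha> :: nat^'n) $ u \<noteq> 0 \<Longrightarrow> \<alpha> - axis u 1 + axis u 1 = \<alpha>"
  by (auto simp: vec_eq_iff axis_def)

lemma add_axis_simps [simp]:
  "(\<alpha> + axis u (1::nat)) $ u = Suc (\<alpha> $ u)" "\<alpha> + axis u (1::nat) - axis u 1 = \<alpha>"
  by (auto simp: vec_eq_iff axis_def)

text \<open>The range of the shift by \<open>axis u 1\<close> consists of the indices with positive
  u-th component, and g vanishes off it. This reindexing moves M_u, its adjoint and B_u onto
  coefficient sequences.\<close>

lemma has_sum_shift: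
  fixes g :: "nat^3 \<Rightarrow> 'a::{comm_monoid_add, t2_space}"
  assumes "\<And>\<alpha>. \<alpha> $ u = 0 \<Longrightarrow> g \<alpha> = 0"
  shows "((\<lambda>\<alpha>. g (\<alpha> + axis u 1)) has_sum S) UNIV \<longleftrightarrow> (g has_sum S) UNIV"
proof -
  have "(g has_sum S) UNIV \<longleftrightarrow> (g has_sum S) (range (\<lambda>\<alpha>. \<alpha> + axis u 1))"
  proof (rule has_sum_cong_neutral)
    fix \<alpha> assume "\<alpha> \<in> UNIV - range (\<lambda>\<alpha>. \<alpha> + axis u (1::nat))"
    then have "\<alpha> $ u = 0" by (metis DiffD2 diff_axis_add rangeI)
    then show "g \<alpha> = 0" by (rule assms)
  qed auto
  then show ?thesis unfolding has_sum_reindex[OF inj_add_axis] o_def by simp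
qed

lemma infsum_shift:
  fixes g :: "nat^3 \<Rightarrow> 'a::{comm_monoid_add, t2_space}"
  assumes "\<And>\<alpha>. \<alpha> $ u = 0 \<Longrightarrow> g \<alpha> = 0"
  shows "(\<Sum>\<^sub>\<infinity>\<alpha>. g (\<alpha> + axis u 1)) = (\<Sum>\<^sub>\<infinity>\<alpha>. g \<alpha>)"
  by (rule infsum_eqI') (rule has_sum_shift[OF assms])

lemma has_sum_single:
  fixes f :: "'a \<Rightarrow> 'b::{comm_monoid_add, t2_space}"
  assumes "\<And>\<alpha>. \<alpha> \<noteq> \<beta> \<Longrightarrow> f \<alpha> = 0"
  shows "(f has_sum f \<beta>) UNIV"
  by (rule has_sum_finite_neutralI[of "{\<beta>}"]) (use assms in auto)

text \<open>The arithmetic-geometric mean inequality for \<open>x / sqrt t\<close> and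
  \<open>sqrt t * y\<close>, with a factor 2 given away. It serves in place of Cauchy-Schwarz to
  prove absolute convergence from square summability.\<close>

lemma weighted_product_le:
  fixes x y t :: real
  assumes "t > 0"
  shows "x * y \<le> x\<^sup>2 / t + t * y\<^sup>2"
proof -
  have "2 * ((x / sqrt t) * (sqrt t * y)) \<le> (x / sqrt t)\<^sup>2 + (sqrt t * y)\<^sup>2"
    using sum_squares_bound[of "x / sqrt t" "sqrt t * y"] by (simp only: mult.assoc)
  then have "2 * (x * y) \<le> x\<^sup>2 / t + t * y\<^sup>2" using assms by (simp add: power_divide power_mult_distrib)
  moreover have "0 \<le> x\<^sup>2 / t + t * y\<^sup>2" using assms by simp
  ultimately show ?thesis by linarith
qed

section \<open>Functions as weighted coefficient sequences\<close>

definition Vq_energy :: "(nat^3 \<Rightarrow> real) \<Rightarrow> (nat^3 \<Rightarrow> quat) \<Rightarrow> real" where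
  "Vq_energy c a = (\<Sum>\<^sub>\<infinity>\<alpha>. c \<alpha> * (norm (a \<alpha>))\<^sup>2)"

definition Vq_unit :: "nat^3 \<Rightarrow> nat^3 \<Rightarrow> quat" where
  "Vq_unit \<beta> = (\<lambda>\<alpha>. if \<alpha> = \<beta> then 1 else 0)"

text \<open>The action of M_u on coefficients. Subtraction of naturals truncates, so indices with
  zero u-th component are treated separately.\<close>

definition Vq_forward :: "3 \<Rightarrow> (nat^3 \<Rightarrow> quat) \<Rightarrow> nat^3 \<Rightarrow> quat" where
  "Vq_forward u a = (\<lambda>\<alpha>. if \<alpha> $ u = 0 then 0 else a (\<alpha> - axis u 1))"

text \<open>The adjoint of \<open>Vq_forward u\<close> for the inner product weighted by c; the
  quotient converts the weight at \<alpha> + e_u into the weight at \<alpha>.\<close>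

definition Vq_backward :: "(nat^3 \<Rightarrow> real) \<Rightarrow> 3 \<Rightarrow> (nat^3 \<Rightarrow> quat) \<Rightarrow> nat^3 \<Rightarrow> quat" where
  "Vq_backward c u a = (\<lambda>\<alpha>. (c (\<alpha> + axis u 1) / c \<alpha>) *\<^sub>R a (\<alpha> + axis u 1))"

lemma Vq_abs_conv_summable:
  "Vq_abs_conv \<Omega> a \<Longrightarrow> x \<in> \<Omega> \<Longrightarrow> (\<lambda>\<alpha>. Vq_mu_pow \<alpha> x * a \<alpha>) summable_on UNIV"
  unfolding Vq_abs_conv_def by (blast intro: abs_summable_summable)

text \<open>Enough to identify functions with coefficients: \<open>box\<close> gives uniqueness, and
  by \<open>conv\<close> every admissible sequence defines a function. It is kept apart from
  \<open>Vq_rkhs\<close> so that it can be used while the reproducing property is still being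
  proved.\<close>

locale Vq_weighted_space =
  fixes c :: "nat^3 \<Rightarrow> real" and \<Omega> :: "quat set"
  assumes pos: "\<And>\<alpha>. c \<alpha> > 0"
    and box: "\<exists>r R \<rho>. 0 < r \<and> r < R \<and> 0 < \<rho> \<and> Vq_Omega r R \<rho> \<subseteq> \<Omega>"
    and conv: "\<And>a. a \<in> Vq_coeff_space c \<Longrightarrow> Vq_abs_conv \<Omega> a"
begin

lemma pos_simps [simp]: "0 \<le> c \<alpha>" "c \<alpha> \<noteq> 0" "\<bar>c \<alpha>\<bar> = c \<alpha>"
  using pos[of \<alpha>] by auto

lemma coeff_series: "a \<in> Vq_coeff_space c \<Longrightarrow> Vq_coeff \<Omega> (Vq_series \<Omega> a) = a"
  using box Vq_coeff_series[OF conv] by metis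

lemma series_inject:
  "a \<in> Vq_coeff_space c \<Longrightarrow> b \<in> Vq_coeff_space c \<Longrightarrow> Vq_series \<Omega> a = Vq_series \<Omega> b \<longleftrightarrow> a = b"
  using coeff_series by metis

lemma series_in_space: "a \<in> Vq_coeff_space c \<Longrightarrow> Vq_series \<Omega> a \<in> Vq_space c \<Omega>"
  by (simp add: Vq_space_def)

lemma ball_space: "(\<forall>f\<in>Vq_space c \<Omega>. P f) \<longleftrightarrow> (\<forall>a\<in>Vq_coeff_space c. P (Vq_series \<Omega> a))"
  by (simp add: Vq_space_def)

lemma summable_terms:
  "a \<in> Vq_coeff_space c \<Longrightarrow> x \<in> \<Omega> \<Longrightarrow> (\<lambda>\<alpha>. Vq_mu_pow \<alpha> x * a \<alpha>) summable_on UNIV"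
  using conv Vq_abs_conv_summable by blast

lemma coeff_space_add:
  assumes "a \<in> Vq_coeff_space c" "b \<in> Vq_coeff_space c"
  shows "(\<lambda>\<alpha>. a \<alpha> + b \<alpha>) \<in> Vq_coeff_space c"
  unfolding Vq_coeff_space_def mem_Collect_eq
proof (rule summable_on_comparison_test)
  show "(\<lambda>\<alpha>. 2 * (c \<alpha> * (norm (a \<alpha>))\<^sup>2 + c \<alpha> * (norm (b \<alpha>))\<^sup>2)) summable_on UNIV"
    using assms by (intro summable_on_cmult_right summable_on_add) (auto simp: Vq_coeff_space_def)
  fix \<alpha>
  have "(norm (a \<alpha> + b \<alpha>))\<^sup>2 \<le> (norm (a \<alpha>) + norm (b \<alpha>))\<^sup>2"
    by (intro power_mono norm_triangle_ineq) auto
  also have "\<dots> \<le> 2 * ((norm (a \<alpha>))\<^sup>2 + (norm (b \<alpha>))\<^sup>2)"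
    using sum_squares_bound[of "norm (a \<alpha>)" "norm (b \<alpha>)"] by (simp add: power2_sum)
  finally show "c \<alpha> * (norm (a \<alpha> + b \<alpha>))\<^sup>2 \<le> 2 * (c \<alpha> * (norm (a \<alpha>))\<^sup>2 + c \<alpha> * (norm (b \<alpha>))\<^sup>2)"
    using mult_left_mono[OF _ pos_simps(1)[of \<alpha>]] by (fastforce simp: algebra_simps)
qed auto

lemma coeff_space_mult:
  assumes "a \<in> Vq_coeff_space c"
  shows "(\<lambda>\<alpha>. a \<alpha> * q) \<in> Vq_coeff_space c"
proof -
  have "(\<lambda>\<alpha>. c \<alpha> * (norm (a \<alpha>))\<^sup>2 * (norm q)\<^sup>2) summable_on UNIV"
    using assms by (intro summable_on_cmult_left) (auto simp: Vq_coeff_space_def)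
  then show ?thesis by (simp add: Vq_coeff_space_def norm_mult power_mult_distrib mult.assoc)
qed

lemma coeff_space_uminus: "a \<in> Vq_coeff_space c \<Longrightarrow> (\<lambda>\<alpha>. - a \<alpha>) \<in> Vq_coeff_space c"
  by (simp add: Vq_coeff_space_def)

lemma coeff_space_diff:
  assumes "a \<in> Vq_coeff_space c" "b \<in> Vq_coeff_space c"
  shows "(\<lambda>\<alpha>. a \<alpha> - b \<alpha>) \<in> Vq_coeff_space c"
  using coeff_space_add[OF assms(1) coeff_space_uminus[OF assms(2)]] by simp

lemma finite_support_coeff_space:
  assumes "\<And>\<alpha>. \<alpha> \<noteq> \<beta> \<Longrightarrow> a \<alpha> = 0"
  shows "a \<in> Vq_coeff_space c"
  using has_sum_single[of \<beta> "\<lambda>\<alpha>. c \<alpha> * (norm (a \<alpha>))\<^sup>2"] assms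
  by (auto simp: Vq_coeff_space_def intro: has_sum_imp_summable)

lemma unit_coeff_space: "Vq_unit \<beta> \<in> Vq_coeff_space c"
  by (rule finite_support_coeff_space[of \<beta>]) (simp add: Vq_unit_def)

lemma series_add:
  assumes "a \<in> Vq_coeff_space c" "b \<in> Vq_coeff_space c"
  shows "(\<lambda>x. Vq_series \<Omega> a x + Vq_series \<Omega> b x) = Vq_series \<Omega> (\<lambda>\<alpha>. a \<alpha> + b \<alpha>)"
proof
  fix x
  show "Vq_series \<Omega> a x + Vq_series \<Omega> b x = Vq_series \<Omega> (\<lambda>\<alpha>. a \<alpha> + b \<alpha>) x"
    using infsum_add[OF summable_terms[OF assms(1)] summable_terms[OF assms(2)]]
    by (simp add: Vq_series_def zero_ext_def distrib_left)
qed

lemma series_mult: "(\<lambda>x. Vq_series \<Omega> a x * q) = Vq_series \<Omega> (\<lambda>\<alpha>. a \<alpha> * q)"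
  by (simp add: fun_eq_iff Vq_series_def zero_ext_def infsum_cmult_left' flip: mult.assoc)

lemma series_diff:
  assumes "a \<in> Vq_coeff_space c" "b \<in> Vq_coeff_space c"
  shows "(\<lambda>x. Vq_series \<Omega> a x - Vq_series \<Omega> b x) = Vq_series \<Omega> (\<lambda>\<alpha>. a \<alpha> - b \<alpha>)"
  using series_add[OF assms(1) coeff_space_uminus[OF assms(2)]] series_mult[of b "-1"]
  by (simp add: fun_eq_iff) (metis add_uminus_conv_diff)

lemma inner_series:
  assumes "a \<in> Vq_coeff_space c" "b \<in> Vq_coeff_space c"
  shows "Vq_inner c \<Omega> (Vq_series \<Omega> a) (Vq_series \<Omega> b) = (\<Sum>\<^sub>\<infinity>\<alpha>. c \<alpha> *\<^sub>R (quat_cnj (b \<alpha>) * a \<alpha>))"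
  by (simp add: Vq_inner_def coeff_series assms)

lemma norm_series:
  assumes "a \<in> Vq_coeff_space c"
  shows "Vq_norm c \<Omega> (Vq_series \<Omega> a) = sqrt (Vq_energy c a)"
proof -
  have "((\<lambda>\<alpha>. c \<alpha> * (norm (a \<alpha>))\<^sup>2) has_sum Vq_energy c a) UNIV"
    using assms by (auto simp: Vq_coeff_space_def Vq_energy_def)
  then have "((\<lambda>\<alpha>. of_real (c \<alpha> * (norm (a \<alpha>))\<^sup>2)) has_sum (of_real (Vq_energy c a) :: quat)) UNIV"
    by (rule has_sum_of_real)
  then have "Vq_inner c \<Omega> (Vq_series \<Omega> a) (Vq_series \<Omega> a) = of_real (Vq_energy c a)"
    by (simp add: inner_series assms quat_cnj_mult_self scaleR_conv_of_real infsumI)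
  then show ?thesis by (simp add: Vq_norm_def of_real_def one_quat_def)
qed

lemma inner_unit:
  assumes "a \<in> Vq_coeff_space c"
  shows "Vq_inner c \<Omega> (Vq_series \<Omega> (Vq_unit \<beta>)) (Vq_series \<Omega> a) = c \<beta> *\<^sub>R quat_cnj (a \<beta>)"
  using infsumI[OF has_sum_single[of \<beta> "\<lambda>\<alpha>. c \<alpha> *\<^sub>R (quat_cnj (a \<alpha>) * Vq_unit \<beta> \<alpha>)"]]
  by (simp add: inner_series assms unit_coeff_space) (simp add: Vq_unit_def)

lemma energy_unit: "Vq_energy c (Vq_unit \<beta>) = c \<beta>"
  using infsumI[OF has_sum_single[of \<beta> "\<lambda>\<alpha>. c \<alpha> * (norm (Vq_unit \<beta> \<alpha>))\<^sup>2"]]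
  by (simp add: Vq_energy_def) (simp add: Vq_unit_def)

text \<open>Testing a candidate h against the monomials determines each of its coefficients, because
  the weights are positive. Hence the description in \<open>adjoint_op\<close> has a single solution
  once one is exhibited.\<close>

lemma adjoint_opI:
  assumes "b \<in> Vq_coeff_space c"
    and "\<And>a. a \<in> Vq_coeff_space c \<Longrightarrow>
      ip (T (Vq_series \<Omega> a)) g = Vq_inner c \<Omega> (Vq_series \<Omega> a) (Vq_series \<Omega> b)"
  shows "adjoint_op (Vq_space c \<Omega>) (Vq_inner c \<Omega>) ip T g = Vq_series \<Omega> b"
  unfolding adjoint_op_def
proof (rule the_equality)
  fix h assume h: "h \<in> Vq_space c \<Omega> \<and> (\<forall>f\<in>Vq_space c \<Omega>. ip (T f) g = Vq_inner c \<Omega> f h)"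
  then obtain d where d: "d \<in> Vq_coeff_space c" "h = Vq_series \<Omega> d" by (auto simp: Vq_space_def)
  have "c \<beta> *\<^sub>R quat_cnj (d \<beta>) = c \<beta> *\<^sub>R quat_cnj (b \<beta>)" for \<beta>
    using h d assms(2)[OF unit_coeff_space[of \<beta>]] series_in_space[OF unit_coeff_space[of \<beta>]]
    by (metis assms(1) inner_unit)
  then have "d = b" by (auto simp: fun_eq_iff)
  then show "h = Vq_series \<Omega> b" using d by simp
qed (use assms series_in_space in \<open>auto simp: ball_space\<close>)

lemma bounded_opI:
  assumes T: "\<And>a. a \<in> Vq_coeff_space c \<Longrightarrow> T (Vq_series \<Omega> a) = Vq_series \<Omega> (S a)"
    and S: "\<And>a. a \<in> Vq_coeff_space c \<Longrightarrow> S a \<in> Vq_coeff_space c"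
    and bd: "\<And>a. a \<in> Vq_coeff_space c \<Longrightarrow> Vq_energy c (S a) \<le> K * Vq_energy c a"
    and add: "\<And>a b. S (\<lambda>\<alpha>. a \<alpha> + b \<alpha>) = (\<lambda>\<alpha>. S a \<alpha> + S b \<alpha>)"
    and mult: "\<And>a q. S (\<lambda>\<alpha>. a \<alpha> * q) = (\<lambda>\<alpha>. S a \<alpha> * q)"
  shows "Vq_bounded_op c \<Omega> T"
  unfolding Vq_bounded_op_def ball_space
proof (intro conjI ballI allI exI)
  fix a assume a: "a \<in> Vq_coeff_space c"
  show "T (Vq_series \<Omega> a) \<in> Vq_space c \<Omega>" by (simp add: T S a series_in_space)
  show "T (\<lambda>x. Vq_series \<Omega> a x * q) = (\<lambda>x. T (Vq_series \<Omega> a) x * q)" for q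
    using a by (simp add: series_mult T coeff_space_mult mult)
  show "T (\<lambda>x. Vq_series \<Omega> a x + Vq_series \<Omega> b x) = (\<lambda>x. T (Vq_series \<Omega> a) x + T (Vq_series \<Omega> b) x)"
    if "b \<in> Vq_coeff_space c" for b
    using a that by (simp add: series_add T S coeff_space_add add)
  \<comment> \<open>K bounds squared norms, hence the square root.\<close>
  show "Vq_norm c \<Omega> (T (Vq_series \<Omega> a)) \<le> sqrt K * Vq_norm c \<Omega> (Vq_series \<Omega> a)"
    using a by (simp add: T S norm_series bd flip: real_sqrt_mult)
qed

section \<open>The operators M_u and C and their adjoints\<close>

lemma M_series:
  assumes "a \<in> Vq_coeff_space c"
  shows "Vq_M \<Omega> u (Vq_series \<Omega> a) = Vq_series \<Omega> (Vq_forward u a)"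
proof -
  have "(\<Sum>\<^sub>\<infinity>\<alpha>. Vq_mu_pow (\<alpha> + axis u 1) x * a \<alpha>) = (\<Sum>\<^sub>\<infinity>\<alpha>. Vq_mu_pow \<alpha> x * Vq_forward u a \<alpha>)" for x
    by (subst infsum_shift[of u, symmetric]) (auto simp: Vq_forward_def)
  then show ?thesis
    by (simp add: Vq_M_def Vq_op_def coeff_series assms) (simp add: Vq_series_def)
qed

text \<open>After reindexing, the energy of the shifted sequence is the sum of c_{\<alpha>+e_u}
  |a_\<alpha>|^2, which is compared term by term with K times the energy of a.\<close>

lemma forward_bounded:
  assumes K: "\<And>\<alpha>. c (\<alpha> + axis u 1) \<le> K * c \<alpha>" and a: "a \<in> Vq_coeff_space c"
  shows "Vq_forward u a \<in> Vq_coeff_space c" "Vq_energy c (Vq_forward u a) \<le> K * Vq_energy c a"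
proof -
  have le: "c (\<alpha> + axis u 1) * (norm (a \<alpha>))\<^sup>2 \<le> K * (c \<alpha> * (norm (a \<alpha>))\<^sup>2)" for \<alpha>
    using mult_right_mono[OF K] by (simp add: mult.assoc)
  have sm: "(\<lambda>\<alpha>. K * (c \<alpha> * (norm (a \<alpha>))\<^sup>2)) summable_on UNIV"
    using a by (intro summable_on_cmult_right) (simp add: Vq_coeff_space_def)
  have sm': "(\<lambda>\<alpha>. c (\<alpha> + axis u 1) * (norm (a \<alpha>))\<^sup>2) summable_on UNIV"
    by (rule summable_on_comparison_test[OF sm]) (use le in auto)
  then have "((\<lambda>\<alpha>. c \<alpha> * (norm (Vq_forward u a \<alpha>))\<^sup>2) has_sum
      (\<Sum>\<^sub>\<infinity>\<alpha>. c (\<alpha> + axis u 1) * (norm (a \<alpha>))\<^sup>2)) UNIV"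
    by (subst has_sum_shift[of u, symmetric]) (auto simp: Vq_forward_def)
  moreover have "(\<Sum>\<^sub>\<infinity>\<alpha>. c (\<alpha> + axis u 1) * (norm (a \<alpha>))\<^sup>2) \<le> K * Vq_energy c a"
    using infsum_mono[OF sm' sm] le by (simp add: Vq_energy_def infsum_cmult_right')
  ultimately show "Vq_forward u a \<in> Vq_coeff_space c"
      "Vq_energy c (Vq_forward u a) \<le> K * Vq_energy c a"
    by (auto simp: Vq_coeff_space_def Vq_energy_def infsumI intro: has_sum_imp_summable)
qed

text \<open>Necessity is seen on monomials: M_u takes one of squared norm c_\<alpha> to one of
  squared norm c_{\<alpha>+e_u}, so the square of an operator bound serves as K.\<close>

lemma M_bounded_iff: "Vq_bounded_op c \<Omega> (Vq_M \<Omega> u) \<longleftrightarrow> (\<exists>K. \<forall>\<alpha>. c (\<alpha> + axis u 1) \<le> K * c \<alpha>)"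
proof
  assume L: "Vq_bounded_op c \<Omega> (Vq_M \<Omega> u)"
  have fwd: "Vq_forward u (Vq_unit \<alpha>) = Vq_unit (\<alpha> + axis u 1)" for \<alpha>
  proof
    fix \<beta> :: "nat^3"
    show "Vq_forward u (Vq_unit \<alpha>) \<beta> = Vq_unit (\<alpha> + axis u 1) \<beta>"
      using diff_axis_add[of \<beta> u]
      by (cases "\<beta> $ u = 0") (auto simp: Vq_forward_def Vq_unit_def)
  qed
  obtain B where B: "\<And>a. a \<in> Vq_coeff_space c \<Longrightarrow>
      Vq_norm c \<Omega> (Vq_M \<Omega> u (Vq_series \<Omega> a)) \<le> B * Vq_norm c \<Omega> (Vq_series \<Omega> a)"
    using L unfolding Vq_bounded_op_def ball_space by blast
  have "c (\<alpha> + axis u 1) \<le> B\<^sup>2 * c \<alpha>" for \<alpha>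
  proof -
    have "sqrt (c (\<alpha> + axis u 1)) \<le> B * sqrt (c \<alpha>)"
      using B[OF unit_coeff_space[of \<alpha>]]
      by (simp add: M_series norm_series unit_coeff_space fwd energy_unit)
    from power_mono[OF this, of 2] show ?thesis by (simp add: power_mult_distrib)
  qed
  then show "\<exists>K. \<forall>\<alpha>. c (\<alpha> + axis u 1) \<le> K * c \<alpha>" by blast
next
  assume "\<exists>K. \<forall>\<alpha>. c (\<alpha> + axis u 1) \<le> K * c \<alpha>"
  then obtain K where K: "\<And>\<alpha>. c (\<alpha> + axis u 1) \<le> K * c \<alpha>" by blast
  show "Vq_bounded_op c \<Omega> (Vq_M \<Omega> u)"
    by (rule bounded_opI[where S = "Vq_forward u", OF M_series])
      (use forward_bounded[of u K] K in \<open>auto simp: Vq_forward_def fun_eq_iff\<close>)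
qed

text \<open>Put g(\<alpha>) = c_\<alpha> |a_\<alpha>|^2. The \<alpha>-th term of the new energy is
  g(\<alpha>+e_u) times a weight quotient that is at most K, and the values g(\<alpha>+e_u) make up
  only part of the energy of a.\<close>

lemma backward_bounded:
  assumes K: "\<And>\<alpha>. c (\<alpha> + axis u 1) \<le> K * c \<alpha>" and a: "a \<in> Vq_coeff_space c"
  shows "Vq_backward c u a \<in> Vq_coeff_space c" "Vq_energy c (Vq_backward c u a) \<le> K * Vq_energy c a"
proof -
  define g where "g \<alpha> = c \<alpha> * (norm (a \<alpha>))\<^sup>2" for \<alpha>
  have g: "g summable_on UNIV" using a by (simp add: g_def[abs_def] Vq_coeff_space_def)
  have "g summable_on range (\<lambda>\<alpha>. \<alpha> + axis u 1)"
    using g by (rule summable_on_subset) auto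
  then have gs: "(\<lambda>\<alpha>. g (\<alpha> + axis u 1)) summable_on UNIV"
    by (simp add: summable_on_reindex[OF inj_add_axis] o_def)
  have "(\<Sum>\<^sub>\<infinity>\<alpha>. g (\<alpha> + axis u 1)) = infsum g (range (\<lambda>\<alpha>. \<alpha> + axis u 1))"
    by (simp add: infsum_reindex[OF inj_add_axis] o_def)
  also have "\<dots> \<le> infsum g UNIV"
    using g summable_on_subset[OF g] by (intro infsum_mono2) (auto simp: g_def)
  finally have le1: "(\<Sum>\<^sub>\<infinity>\<alpha>. g (\<alpha> + axis u 1)) \<le> Vq_energy c a"
    by (simp add: g_def[abs_def] Vq_energy_def)
  \<comment> \<open>From 0 < c_{e_u} <= K c_0.\<close>
  have K0: "K \<ge> 0" using K[of 0] pos[of 0] pos[of "0 + axis u 1"]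
    by (smt (verit, best) mult_nonneg_nonneg mult_nonpos_nonneg)
  have le: "c \<alpha> * (norm (Vq_backward c u a \<alpha>))\<^sup>2 \<le> K * g (\<alpha> + axis u 1)" for \<alpha>
  proof -
    have "c \<alpha> * (norm (Vq_backward c u a \<alpha>))\<^sup>2 = (c (\<alpha> + axis u 1) / c \<alpha>) * g (\<alpha> + axis u 1)"
      by (simp add: Vq_backward_def g_def power_mult_distrib power_divide power2_eq_square)
    also have "\<dots> \<le> K * g (\<alpha> + axis u 1)"
      using K[of \<alpha>] pos[of \<alpha>] by (intro mult_right_mono) (auto simp: g_def divide_simps)
    finally show ?thesis .
  qed
  have sm: "(\<lambda>\<alpha>. K * g (\<alpha> + axis u 1)) summable_on UNIV" using gs by (rule summable_on_cmult_right)
  have sm': "(\<lambda>\<alpha>. c \<alpha> * (norm (Vq_backward c u a \<alpha>))\<^sup>2) summable_on UNIV"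
    by (rule summable_on_comparison_test[OF sm]) (use le in auto)
  then show "Vq_backward c u a \<in> Vq_coeff_space c" by (simp add: Vq_coeff_space_def)
  have "Vq_energy c (Vq_backward c u a) \<le> K * (\<Sum>\<^sub>\<infinity>\<alpha>. g (\<alpha> + axis u 1))"
    using infsum_mono[OF sm' sm] le by (simp add: Vq_energy_def infsum_cmult_right')
  also have "\<dots> \<le> K * Vq_energy c a" using le1 K0 by (rule mult_left_mono)
  finally show "Vq_energy c (Vq_backward c u a) \<le> K * Vq_energy c a" .
qed

text \<open>Reindexing the inner product moves the shift from a to b; boundedness of M_u supplies
  the K that keeps the backward shift inside the space.\<close>

lemma M_adj_series:
  assumes bd: "Vq_bounded_op c \<Omega> (Vq_M \<Omega> u)" and b: "b \<in> Vq_coeff_space c"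
  shows "Vq_M_adj c \<Omega> u (Vq_series \<Omega> b) = Vq_series \<Omega> (Vq_backward c u b)"
    "Vq_backward c u b \<in> Vq_coeff_space c"
proof -
  obtain K where K: "\<And>\<alpha>. c (\<alpha> + axis u 1) \<le> K * c \<alpha>" using bd by (auto simp: M_bounded_iff)
  show bw: "Vq_backward c u b \<in> Vq_coeff_space c" by (rule backward_bounded[OF K b])
  have fw: "Vq_forward u a \<in> Vq_coeff_space c" if "a \<in> Vq_coeff_space c" for a
    by (rule forward_bounded[OF K that])
  show "Vq_M_adj c \<Omega> u (Vq_series \<Omega> b) = Vq_series \<Omega> (Vq_backward c u b)"
    unfolding Vq_M_adj_def
  proof (rule adjoint_opI[OF bw])
    fix a assume a: "a \<in> Vq_coeff_space c"
    have "Vq_inner c \<Omega> (Vq_M \<Omega> u (Vq_series \<Omega> a)) (Vq_series \<Omega> b) =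
        (\<Sum>\<^sub>\<infinity>\<alpha>. c \<alpha> *\<^sub>R (quat_cnj (b \<alpha>) * Vq_forward u a \<alpha>))"
      by (simp add: M_series a inner_series fw b)
    also have "\<dots> = (\<Sum>\<^sub>\<infinity>\<alpha>. c (\<alpha> + axis u 1) *\<^sub>R (quat_cnj (b (\<alpha> + axis u 1)) * a \<alpha>))"
      by (subst infsum_shift[of u, symmetric]) (auto simp: Vq_forward_def)
    also have "\<dots> = Vq_inner c \<Omega> (Vq_series \<Omega> a) (Vq_series \<Omega> (Vq_backward c u b))"
      unfolding inner_series[OF a bw] by (simp add: Vq_backward_def)
    finally show "Vq_inner c \<Omega> (Vq_M \<Omega> u (Vq_series \<Omega> a)) (Vq_series \<Omega> b) =
        Vq_inner c \<Omega> (Vq_series \<Omega> a) (Vq_series \<Omega> (Vq_backward c u b))" .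
  qed
qed

text \<open>Only the term \<alpha> = 0 of the inner product survives; it carries the weight c_0,
  which the division compensates.\<close>

lemma C_adj_series:
  "Vq_C_adj c \<Omega> q = Vq_series \<Omega> (\<lambda>\<alpha>. if \<alpha> = 0 then q /\<^sub>R c 0 else 0)"
  unfolding Vq_C_adj_def
proof (rule adjoint_opI)
  show cs: "(\<lambda>\<alpha>. if \<alpha> = 0 then q /\<^sub>R c 0 else 0) \<in> Vq_coeff_space c"
    by (rule finite_support_coeff_space[of 0]) auto
  fix a assume a: "a \<in> Vq_coeff_space c"
  show "quat_ip (Vq_C \<Omega> (Vq_series \<Omega> a)) q =
      Vq_inner c \<Omega> (Vq_series \<Omega> a) (Vq_series \<Omega> (\<lambda>\<alpha>. if \<alpha> = 0 then q /\<^sub>R c 0 else 0))"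
    using infsumI[OF has_sum_single[of 0
      "\<lambda>\<alpha>. c \<alpha> *\<^sub>R (quat_cnj (if \<alpha> = 0 then q /\<^sub>R c 0 else 0) * a \<alpha>)"]]
    by (simp add: inner_series a cs quat_ip_def Vq_C_def coeff_series)
qed

text \<open>M_u M_u* acts on \<mu>^\<alpha> as the scalar c_\<alpha> / c_{\<alpha>-e_u}, or as 0 if
  \<alpha>_u = 0, while C* C is 1 / c_0 at \<alpha> = 0 and 0 elsewhere. Comparing scalars and
  dividing by c_\<alpha> gives the recurrence.\<close>

lemma structural_identity_iff:
  assumes bd: "\<And>u. Vq_bounded_op c \<Omega> (Vq_M \<Omega> u)"
  shows "Vq_structural_identity c \<Omega> \<longleftrightarrow> c 0 = 1 \<and>
    (\<forall>\<alpha>. \<alpha> \<noteq> 0 \<longrightarrow> (\<Sum>u\<in>UNIV. if \<alpha> $ u = 0 then 0 else 1 / c (\<alpha> - axis u 1)) = 1 / c \<alpha>)"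
proof -
  define w where "w u \<alpha> = (if \<alpha> $ u = 0 then 0 else c \<alpha> / c (\<alpha> - axis u 1))" for u \<alpha>
  \<comment> \<open>The eigenvalue at \<mu>^\<alpha> of the sum of the M_u M_u*.\<close>
  define W where "W \<alpha> = (\<Sum>u\<in>UNIV. w u \<alpha>)" for \<alpha>
  have MM: "Vq_M \<Omega> u (Vq_M_adj c \<Omega> u (Vq_series \<Omega> a)) = Vq_series \<Omega> (\<lambda>\<alpha>. w u \<alpha> *\<^sub>R a \<alpha>) \<and>
      (\<lambda>\<alpha>. w u \<alpha> *\<^sub>R a \<alpha>) \<in> Vq_coeff_space c"
    if a: "a \<in> Vq_coeff_space c" for a u
  proof -
    obtain K where K: "\<And>\<alpha>. c (\<alpha> + axis u 1) \<le> K * c \<alpha>" using bd by (auto simp: M_bounded_iff)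
    have "Vq_forward u (Vq_backward c u a) = (\<lambda>\<alpha>. w u \<alpha> *\<^sub>R a \<alpha>)"
      by (auto simp: Vq_forward_def Vq_backward_def w_def fun_eq_iff diff_axis_add)
    then show ?thesis
      using forward_bounded(1)[OF K M_adj_series(2)[OF bd a]]
      by (metis M_adj_series[OF bd a] M_series)
  qed
  have lhs: "(\<lambda>x. Vq_series \<Omega> a x - (\<Sum>u\<in>UNIV. Vq_M \<Omega> u (Vq_M_adj c \<Omega> u (Vq_series \<Omega> a)) x)) =
      Vq_series \<Omega> (\<lambda>\<alpha>. (1 - W \<alpha>) *\<^sub>R a \<alpha>) \<and> (\<lambda>\<alpha>. (1 - W \<alpha>) *\<^sub>R a \<alpha>) \<in> Vq_coeff_space c"
    if a: "a \<in> Vq_coeff_space c" for a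
  proof -
    define s where "s u \<alpha> = w u \<alpha> *\<^sub>R a \<alpha>" for u \<alpha>
    have s: "s u \<in> Vq_coeff_space c" "Vq_M \<Omega> u (Vq_M_adj c \<Omega> u (Vq_series \<Omega> a)) = Vq_series \<Omega> (s u)" for u
      using MM[OF a, of u] by (auto simp: s_def[abs_def])
    note cs = coeff_space_add[OF s(1)[of 1] s(1)[of 2]]
    note cs' = coeff_space_add[OF cs s(1)[of 3]]
    have "(\<lambda>\<alpha>. a \<alpha> - (s 1 \<alpha> + s 2 \<alpha> + s 3 \<alpha>)) = (\<lambda>\<alpha>. (1 - W \<alpha>) *\<^sub>R a \<alpha>)"
      by (simp add: s_def W_def sum_3 algebra_simps)
    then show ?thesis
      using fun_cong[OF series_add[OF s(1)[of 1] s(1)[of 2]]]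
        fun_cong[OF series_add[OF cs s(1)[of 3]]] series_diff[OF a cs'] coeff_space_diff[OF a cs']
      by (simp add: s(2) sum_3)
  qed
  have cs0: "(\<lambda>\<alpha>. if \<alpha> = 0 then q else 0) \<in> Vq_coeff_space c" for q
    by (rule finite_support_coeff_space[of 0]) auto
  have "Vq_structural_identity c \<Omega> \<longleftrightarrow> (\<forall>a\<in>Vq_coeff_space c.
      (\<lambda>\<alpha>. (1 - W \<alpha>) *\<^sub>R a \<alpha>) = (\<lambda>\<alpha>. if \<alpha> = 0 then a 0 /\<^sub>R c 0 else 0))"
    unfolding Vq_structural_identity_def ball_space
    by (intro ball_cong refl) (simp add: lhs C_adj_series Vq_C_def coeff_series series_inject cs0)
  also have "\<dots> \<longleftrightarrow> (\<forall>\<alpha>. 1 - W \<alpha> = (if \<alpha> = 0 then 1 / c 0 else 0))" (is "?L \<longleftrightarrow> ?R")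
  proof
    assume ?L
    show ?R
    proof
      fix \<alpha>
      \<comment> \<open>Testing on the monomial \<mu>^\<alpha> isolates its scalar.\<close>
      have "(1 - W \<alpha>) *\<^sub>R (1::quat) = (if \<alpha> = 0 then 1 /\<^sub>R c 0 else 0)"
        using fun_cong[OF bspec[OF \<open>?L\<close> unit_coeff_space[of \<alpha>]], of \<alpha>]
        by (auto simp: Vq_unit_def split: if_splits)
      then show "1 - W \<alpha> = (if \<alpha> = 0 then 1 / c 0 else 0)"
        by (auto simp: inverse_eq_divide split: if_splits dest: arg_cong[of _ _ quat_re]
            simp: one_quat_def)
    qed
  next
    assume ?R
    then show ?L by (auto simp: fun_eq_iff inverse_eq_divide)
  qed
  also have "\<dots> \<longleftrightarrow> c 0 = 1 \<and> (\<forall>\<alpha>. \<alpha> \<noteq> 0 \<longrightarrow> W \<alpha> = 1)"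
  proof -
    \<comment> \<open>No index lies below 0, so the condition at \<alpha> = 0 reads 1 = 1 /
      c_0.\<close>
    have "W 0 = 0" by (simp add: W_def w_def)
    then show ?thesis by auto
  qed
  also have "\<dots> \<longleftrightarrow> c 0 = 1 \<and>
    (\<forall>\<alpha>. \<alpha> \<noteq> 0 \<longrightarrow> (\<Sum>u\<in>UNIV. if \<alpha> $ u = 0 then 0 else 1 / c (\<alpha> - axis u 1)) = 1 / c \<alpha>)"
  proof -
    have "W \<alpha> = c \<alpha> * (\<Sum>u\<in>UNIV. if \<alpha> $ u = 0 then 0 else 1 / c (\<alpha> - axis u 1))" for \<alpha>
      by (simp add: W_def w_def sum_distrib_left if_distrib cong: if_cong)
    then show ?thesis by (auto simp: field_simps)
  qed
  finally show ?thesis .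
qed

end

section \<open>Reproducing property and square summability of the monomials\<close>

lemma Vq_rkhs_weighted_space: "Vq_rkhs c \<Omega> \<Longrightarrow> Vq_weighted_space c \<Omega>"
  unfolding Vq_rkhs_def by unfold_locales auto

text \<open>Testing the reproducing property on \<open>\<mu>\<^sup>\<alpha>\<close> identifies the coefficients of the kernel at \<open>y\<close>.\<close>

lemma Vq_rkhs_summable:
  assumes "Vq_rkhs c \<Omega>" "y \<in> \<Omega>"
  shows "(\<lambda>\<alpha>. (norm (Vq_mu_pow \<alpha> y))\<^sup>2 / c \<alpha>) summable_on UNIV"
proof -
  interpret Vq_weighted_space c \<Omega> by (rule Vq_rkhs_weighted_space[OF assms(1)])
  define k where "k = zero_ext \<Omega> (\<lambda>x. Vq_kernel c x y)"
  have "k \<in> Vq_space c \<Omega>" and rep: "\<And>f. f \<in> Vq_space c \<Omega> \<Longrightarrow> Vq_inner c \<Omega> f k = f y"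
    using assms by (auto simp: Vq_rkhs_def k_def)
  then obtain b where b: "b \<in> Vq_coeff_space c" "k = Vq_series \<Omega> b" by (auto simp: Vq_space_def)
  have "c \<alpha> * (norm (b \<alpha>))\<^sup>2 = (norm (Vq_mu_pow \<alpha> y))\<^sup>2 / c \<alpha>" for \<alpha>
  proof -
    have "c \<alpha> *\<^sub>R quat_cnj (b \<alpha>) = Vq_series \<Omega> (Vq_unit \<alpha>) y"
      using rep[OF series_in_space[OF unit_coeff_space]] b inner_unit by simp
    also have "\<dots> = Vq_mu_pow \<alpha> y"
      using infsumI[OF has_sum_single[of \<alpha> "\<lambda>\<beta>. Vq_mu_pow \<beta> y * Vq_unit \<alpha> \<beta>"]] assms(2)
      by (simp add: Vq_series_def zero_ext_def) (simp add: Vq_unit_def)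
    finally have "norm (Vq_mu_pow \<alpha> y) = c \<alpha> * norm (b \<alpha>)"
      by (metis norm_scaleR pos_simps(3) quat_cnj_simps(2))
    then show ?thesis by (simp add: power_mult_distrib power2_eq_square)
  qed
  then show ?thesis using b(1) by (simp add: Vq_coeff_space_def)
qed

text \<open>The summability hypothesis does double duty: it makes every series of the space converge
  absolutely at x, and it says that the kernel at x has admissible coefficients.\<close>

lemma Vq_rkhsI:
  assumes pos: "\<And>\<alpha>. c \<alpha> > 0" and sub: "\<Omega> \<subseteq> Hstar"
    and box: "\<exists>r R \<rho>. 0 < r \<and> r < R \<and> 0 < \<rho> \<and> Vq_Omega r R \<rho> \<subseteq> \<Omega>"
    and sm: "\<And>x. x \<in> \<Omega> \<Longrightarrow> (\<lambda>\<alpha>. (norm (Vq_mu_pow \<alpha> x))\<^sup>2 / c \<alpha>) summable_on UNIV"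
  shows "Vq_rkhs c \<Omega>"
proof -
  have conv: "Vq_abs_conv \<Omega> a" if a: "a \<in> Vq_coeff_space c" for a
    unfolding Vq_abs_conv_def
  proof
    fix x assume x: "x \<in> \<Omega>"
    have "(\<lambda>\<alpha>. (norm (Vq_mu_pow \<alpha> x))\<^sup>2 / c \<alpha> + c \<alpha> * (norm (a \<alpha>))\<^sup>2) summable_on UNIV"
      using sm[OF x] a by (intro summable_on_add) (auto simp: Vq_coeff_space_def)
    then show "(\<lambda>\<alpha>. norm (Vq_mu_pow \<alpha> x * a \<alpha>)) summable_on UNIV"
      by (rule summable_on_comparison_test) (auto simp: norm_mult intro: weighted_product_le pos)
  qed
  interpret Vq_weighted_space c \<Omega> by unfold_locales (use pos box conv in auto)
  have "zero_ext \<Omega> (\<lambda>x. Vq_kernel c x y) \<in> Vq_space c \<Omega> \<and>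
      (\<forall>f\<in>Vq_space c \<Omega>. Vq_inner c \<Omega> f (zero_ext \<Omega> (\<lambda>x. Vq_kernel c x y)) = f y)"
    if y: "y \<in> \<Omega>" for y
  proof -
    \<comment> \<open>Coefficients of the kernel at y; the factor 1 / c_\<alpha> cancels the weight
      of the inner product, leaving evaluation at y.\<close>
    define k where "k \<alpha> = quat_cnj (Vq_mu_pow \<alpha> y) /\<^sub>R c \<alpha>" for \<alpha>
    have eq: "zero_ext \<Omega> (\<lambda>x. Vq_kernel c x y) = Vq_series \<Omega> k"
      by (simp add: Vq_series_def Vq_kernel_def k_def)
    have k: "k \<in> Vq_coeff_space c"
      using sm[OF y]
      by (simp add: Vq_coeff_space_def k_def power_mult_distrib power2_eq_square[of "inverse _"]
          inverse_eq_divide power_divide power2_eq_square[of "c _"])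
    have "Vq_inner c \<Omega> (Vq_series \<Omega> a) (Vq_series \<Omega> k) = Vq_series \<Omega> a y"
      if "a \<in> Vq_coeff_space c" for a
      using that y by (simp add: inner_series k k_def) (simp add: Vq_series_def zero_ext_def)
    then show ?thesis by (simp add: eq ball_space series_in_space k)
  qed
  then show ?thesis unfolding Vq_rkhs_def using pos sub box conv by auto
qed

subsection \<open>The Arveson weight\<close>

lemma midx_fact_pos: "midx_fact \<alpha> > 0"
  by (simp add: midx_fact_def)

lemma arveson_weight_pos: "arveson_weight \<alpha> > 0"
  by (simp add: arveson_weight_def midx_fact_pos)

lemma arveson_weight_0: "arveson_weight 0 = 1"
  by (simp add: arveson_weight_def midx_fact_def midx_abs_def)

lemma midx_abs_add_axis: "midx_abs (\<alpha> + axis u 1) = Suc (midx_abs \<alpha>)"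
  using exhaust_3[of u] by (auto simp: midx_abs_def axis_def)

lemma midx_fact_add_axis: "midx_fact (\<alpha> + axis u 1) = Suc (\<alpha> $ u) * midx_fact \<alpha>"
proof -
  have "fact (n + 1) = Suc n * (fact n :: nat)" for n by (simp flip: Suc_eq_plus1)
  then show ?thesis
    using exhaust_3[of u] by (auto simp: midx_fact_def axis_def distrib_left distrib_right mult_ac)
qed

lemma arveson_weight_add_axis:
  "arveson_weight (\<alpha> + axis u 1) = real (Suc (\<alpha> $ u)) / real (Suc (midx_abs \<alpha>)) * arveson_weight \<alpha>"
  unfolding arveson_weight_def midx_abs_add_axis midx_fact_add_axis by (simp add: algebra_simps)

text \<open>The ratio (\<alpha>_u + 1) / (|\<alpha>| + 1) is at most 1. The explicit factor 1 is the
  K of \<open>M_bounded_iff\<close>.\<close>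

lemma arveson_weight_add_axis_le: "arveson_weight (\<alpha> + axis u 1) \<le> 1 * arveson_weight \<alpha>"
proof -
  have "\<alpha> $ u \<le> midx_abs \<alpha>" using exhaust_3[of u] by (auto simp: midx_abs_def)
  then show ?thesis unfolding arveson_weight_add_axis
    using arveson_weight_pos[of \<alpha>] by (intro mult_right_mono) auto
qed

text \<open>Pascal's rule for multinomial coefficients: the u-th summand is the fraction \<alpha>_u
  / |\<alpha>| of the right-hand side, and these fractions add up to 1.\<close>

lemma arveson_weight_recurrence:
  assumes "\<alpha> \<noteq> 0"
  shows "(\<Sum>u\<in>UNIV. if \<alpha> $ u = 0 then 0 else 1 / arveson_weight (\<alpha> - axis u 1)) = 1 / arveson_weight \<alpha>"
proof -
  have "midx_abs \<alpha> \<noteq> 0" using assms by (auto simp: midx_abs_def vec_eq_iff forall_3)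
  have "(if \<alpha> $ u = 0 then 0 else 1 / arveson_weight (\<alpha> - axis u 1)) =
      real (\<alpha> $ u) / real (midx_abs \<alpha>) * (1 / arveson_weight \<alpha>)" for u
  proof (cases "\<alpha> $ u = 0")
    case False
    \<comment> \<open>Writing \<alpha> as \<beta> + e_u replaces truncated subtraction by the rules
      for adding a unit.\<close>
    define \<beta> where "\<beta> = \<alpha> - axis u 1"
    have \<alpha>: "\<alpha> = \<beta> + axis u 1" using diff_axis_add[OF False] by (simp add: \<beta>_def)
    show ?thesis
      using arveson_weight_pos[of \<beta>] False
      unfolding \<alpha> arveson_weight_add_axis midx_abs_add_axis add_axis_simps
      by (simp del: of_nat_Suc)
  qed simp
  then have "(\<Sum>u\<in>UNIV. if \<alpha> $ u = 0 then 0 else 1 / arveson_weight (\<alpha> - axis u 1)) =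
      (\<Sum>u\<in>UNIV. real (\<alpha> $ u)) / real (midx_abs \<alpha>) * (1 / arveson_weight \<alpha>)"
    by (simp add: sum_divide_distrib sum_distrib_right)
  also have "(\<Sum>u\<in>UNIV. real (\<alpha> $ u)) = real (midx_abs \<alpha>)" by (simp add: sum_3 midx_abs_def)
  finally show ?thesis using \<open>midx_abs \<alpha> \<noteq> 0\<close> by simp
qed

text \<open>The recurrence expresses c at \<alpha> through indices of total degree |\<alpha>| - 1,
  so induction on the degree applies.\<close>

lemma arveson_weight_unique:
  assumes "c 0 = 1"
    and rec: "\<And>\<alpha>. \<alpha> \<noteq> 0 \<Longrightarrow>
      (\<Sum>u\<in>UNIV. if \<alpha> $ u = 0 then 0 else 1 / c (\<alpha> - axis u 1)) = 1 / c \<alpha>"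
  shows "c = arveson_weight"
proof
  fix \<alpha>
  show "c \<alpha> = arveson_weight \<alpha>"
  proof (induction "midx_abs \<alpha>" arbitrary: \<alpha> rule: less_induct)
    case less
    show ?case
    proof (cases "\<alpha> = 0")
      case False
      have "c (\<alpha> - axis u 1) = arveson_weight (\<alpha> - axis u 1)" if "\<alpha> $ u \<noteq> 0" for u
        using less[of "\<alpha> - axis u 1"] midx_abs_add_axis[of "\<alpha> - axis u 1" u] diff_axis_add[OF that]
        by simp
      then have "(\<Sum>u\<in>UNIV. if \<alpha> $ u = 0 then 0 else 1 / c (\<alpha> - axis u 1)) =
          (\<Sum>u\<in>UNIV. if \<alpha> $ u = 0 then 0 else 1 / arveson_weight (\<alpha> - axis u 1))"
        by (intro sum.cong) auto
      then show ?thesis using rec[OF False] arveson_weight_recurrence[OF False] by simp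
    qed (simp add: assms arveson_weight_0)
  qed
qed

section \<open>A box inside the Arveson domain\<close>

lemma fact_le_binomial_bound: "fact (m + n) \<le> (2::nat) ^ (m + n) * (fact m * fact n)"
proof -
  have "fact (m + n) = ((m + n) choose m) * (fact m * fact n :: nat)"
    using binomial_fact_lemma[of m "m + n"] by (simp add: mult_ac)
  also have "\<dots> \<le> 2 ^ (m + n) * (fact m * fact n)"
    by (intro mult_right_mono binomial_le_pow2) auto
  finally show ?thesis .
qed

text \<open>A multinomial coefficient is a product of two binomial coefficients, each at most a
  power of 2; a geometric bound is all that convergence requires.\<close>

lemma fact_midx_abs_le: "fact (midx_abs \<alpha>) \<le> 4 ^ midx_abs \<alpha> * midx_fact \<alpha>"
proof -
  define i j k where "i = \<alpha> $ 1" "j = \<alpha> $ 2" "k = \<alpha> $ 3"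
  have "fact (i + j + k) \<le> (2::nat) ^ (i + j + k) * (fact (i + j) * fact k)"
    by (rule fact_le_binomial_bound)
  also have "\<dots> \<le> 2 ^ (i + j + k) * ((2 ^ (i + j) * (fact i * fact j)) * fact k)"
    by (intro mult_left_mono mult_right_mono fact_le_binomial_bound) auto
  \<comment> \<open>The inner exponent is enlarged so that the two powers of 2 merge into one power
    of 4.\<close>
  also have "\<dots> \<le> 2 ^ (i + j + k) * ((2 ^ (i + j + k) * (fact i * fact j)) * fact k)"
    by (intro mult_left_mono mult_right_mono power_increasing) auto
  also have "\<dots> = 4 ^ (i + j + k) * (fact i * fact j * fact k)"
    by (simp add: mult_ac flip: power_mult_distrib)
  finally show ?thesis by (simp add: i_j_k_def midx_abs_def midx_fact_def)
qed

text \<open>A product of three geometric series, summed one exponent at a time; it is the majorant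
  for the Arveson kernel on the box.\<close>

lemma summable_on_half_powers: "(\<lambda>\<alpha> :: nat^3. (1/2 :: real) ^ midx_abs \<alpha>) summable_on UNIV"
proof -
  have g: "((\<lambda>n. (1/2 :: real) ^ n) has_sum 2) UNIV"
    using sums_nonneg_imp_has_sum[OF geometric_sums[of "1/2 :: real"]] by simp
  have s2: "(\<lambda>(j, k). (1/2 :: real) ^ j * (1/2) ^ k) summable_on UNIV \<times> UNIV"
    using has_sum_cmult_right[OF g]
    by (intro summable_on_SigmaI[where g = "\<lambda>j. (1/2) ^ j * 2"]
        summable_on_cmult_left has_sum_imp_summable[OF g]) auto
  define S where "S = (\<Sum>\<^sub>\<infinity>(j, k). (1/2 :: real) ^ j * (1/2) ^ k)"
  have "((\<lambda>(j, k). (1/2 :: real) ^ j * (1/2) ^ k) has_sum S) UNIV"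
    using has_sum_infsum[OF s2] by (simp add: S_def)
  then have "((\<lambda>p. (1/2 :: real) ^ i * (case p of (j, k) \<Rightarrow> (1/2) ^ j * (1/2) ^ k)) has_sum (1/2) ^ i * S) UNIV" for i
    by (rule has_sum_cmult_right)
  then have "(\<lambda>(i, p). (1/2 :: real) ^ i * (case p of (j, k) \<Rightarrow> (1/2) ^ j * (1/2) ^ k)) summable_on UNIV \<times> UNIV"
    by (intro summable_on_SigmaI[where g = "\<lambda>i. (1/2) ^ i * S"]
        summable_on_cmult_left has_sum_imp_summable[OF g]) auto
  then have "(\<lambda>p. (\<lambda>\<alpha>. (1/2 :: real) ^ midx_abs \<alpha>) (case p of (i, j, k) \<Rightarrow> vector [i, j, k])) summable_on UNIV"
    by (simp add: case_prod_unfold midx_abs_def power_add mult.assoc)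
  then show ?thesis by (subst (asm) summable_on_reindex_bij_betw[OF bij_vector_triple])
qed

text \<open>Since |x_0| < 1/12 < |x_u|, the factor 1 + x_0 / vec x has norm at most 2, while |x_u| <
  1/6. The box is chosen so that (1/3)^2 times the 4 of \<open>fact_midx_abs_le\<close> stays below
  1/2.\<close>

lemma norm_Vq_mu_le:
  assumes "x \<in> Vq_Omega (1/12) (1/6) (1/12)"
  shows "norm (Vq_mu u x) \<le> 1/3"
proof -
  have b: "1/12 < \<bar>quat_vec x $ u\<bar>" "\<bar>quat_vec x $ u\<bar> < 1/6" "\<bar>quat_re x\<bar> < 1/12"
    using assms by (auto simp: Vq_Omega_def)
  have "1/12 < norm (quat_vec x)" using b(1) component_le_norm_cart[of "quat_vec x" u] by linarith
  then have "\<bar>quat_re x\<bar> / norm (quat_vec x) \<le> 1" using b(3) by (simp add: divide_simps)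
  moreover have "norm (Quat 0 (quat_vec x)) = norm (quat_vec x)" by (simp add: norm_quat_def)
  ultimately have "norm (of_real (quat_re x) / Quat 0 (quat_vec x)) \<le> 1"
    by (simp add: divide_inverse norm_mult norm_inverse)
  then have "norm (1 + of_real (quat_re x) / Quat 0 (quat_vec x)) \<le> 1 + 1"
    using norm_triangle_ineq[of 1 "of_real (quat_re x) / Quat 0 (quat_vec x)"] by simp
  then have "norm (Vq_mu u x) \<le> 1/6 * (1 + 1)"
    unfolding Vq_mu_def norm_mult using b by (intro mult_mono) auto
  then show ?thesis by simp
qed

lemma Vq_Omega_subset_Omega_A: "Vq_Omega (1/12) (1/6) (1/12) \<subseteq> Omega_A"
proof
  fix x assume x: "x \<in> Vq_Omega (1/12) (1/6) (1/12)"
  have "quat_vec x \<noteq> 0" using x by (force simp: Vq_Omega_def)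
  moreover have "(\<lambda>\<alpha>. (norm (Vq_mu_pow \<alpha> x))\<^sup>2 * (fact (midx_abs \<alpha>) / real (midx_fact \<alpha>))) summable_on UNIV"
  proof (rule summable_on_comparison_test[OF summable_on_half_powers])
    fix \<alpha>
    have "norm (Vq_mu_pow \<alpha> x) \<le> (1/3) ^ (\<alpha> $ 1) * (1/3) ^ (\<alpha> $ 2) * (1/3) ^ (\<alpha> $ 3)"
      unfolding Vq_mu_pow_def norm_mult norm_power
      by (intro mult_mono power_mono norm_Vq_mu_le[OF x]) auto
    then have "norm (Vq_mu_pow \<alpha> x) \<le> (1/3) ^ midx_abs \<alpha>" by (simp add: midx_abs_def power_add)
    then have "(norm (Vq_mu_pow \<alpha> x))\<^sup>2 \<le> ((1/3) ^ midx_abs \<alpha>)\<^sup>2" by (rule power_mono) simp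
    also have "\<dots> = ((1/3)\<^sup>2) ^ midx_abs \<alpha>" by (simp only: mult.commute flip: power_mult)
    \<comment> \<open>1/9 is rounded up to 1/8 so that the product with 4 is exactly 1/2.\<close>
    also have "\<dots> \<le> (1/8) ^ midx_abs \<alpha>" by (intro power_mono) (auto simp: power2_eq_square)
    finally have 1: "(norm (Vq_mu_pow \<alpha> x))\<^sup>2 \<le> (1/8) ^ midx_abs \<alpha>" .
    have "real (fact (midx_abs \<alpha>)) \<le> real (4 ^ midx_abs \<alpha> * midx_fact \<alpha>)"
      using fact_midx_abs_le of_nat_le_iff by blast
    then have 2: "fact (midx_abs \<alpha>) / real (midx_fact \<alpha>) \<le> 4 ^ midx_abs \<alpha>"
      using midx_fact_pos[of \<alpha>] by (simp add: divide_simps)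
    have "(norm (Vq_mu_pow \<alpha> x))\<^sup>2 * (fact (midx_abs \<alpha>) / real (midx_fact \<alpha>)) \<le>
        (1/8) ^ midx_abs \<alpha> * 4 ^ midx_abs \<alpha>"
      using 1 2 by (intro mult_mono) auto
    also have "\<dots> = (1/2) ^ midx_abs \<alpha>" by (simp flip: power_mult_distrib)
    finally show "(norm (Vq_mu_pow \<alpha> x))\<^sup>2 * (fact (midx_abs \<alpha>) / real (midx_fact \<alpha>)) \<le> (1/2) ^ midx_abs \<alpha>" .
  qed auto
  ultimately show "x \<in> Omega_A" by (simp add: Omega_A_def Hstar_def)
qed

lemma Omega_A_iff:
  "x \<in> Omega_A \<longleftrightarrow> x \<in> Hstar \<and>
    (\<lambda>\<alpha>. (norm (Vq_mu_pow \<alpha> x))\<^sup>2 / arveson_weight \<alpha>) summable_on UNIV"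
  by (simp add: Omega_A_def arveson_weight_def)

section \<open>The Arveson space has the stated properties\<close>

lemma arveson_rkhs: "Vq_rkhs arveson_weight Omega_A"
proof (rule Vq_rkhsI)
  show "\<exists>r R \<rho>. 0 < r \<and> r < R \<and> 0 < \<rho> \<and> Vq_Omega r R \<rho> \<subseteq> Omega_A"
    using Vq_Omega_subset_Omega_A by (intro exI[of _ "1/12"] exI[of _ "1/6"]) auto
qed (auto simp: arveson_weight_pos Omega_A_iff)

interpretation arveson: Vq_weighted_space arveson_weight Omega_A
  by (rule Vq_rkhs_weighted_space[OF arveson_rkhs])

lemma arveson_M_bounded: "Vq_bounded_op arveson_weight Omega_A (Vq_M Omega_A u)"
  using arveson.M_bounded_iff arveson_weight_add_axis_le by blast

lemma arveson_structural_identity: "Vq_structural_identity arveson_weight Omega_A"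
  by (simp add: arveson.structural_identity_iff arveson_M_bounded arveson_weight_0
      arveson_weight_recurrence)

text \<open>The quotient of consecutive Arveson weights, (\<alpha>_u + 1) / (|\<alpha>| + 1), is the
  factor that B_u attaches to \<mu>^{\<alpha>+e_u}; so B_u is the weighted backward shift, that is,
  the adjoint of M_u.\<close>

lemma arveson_B_series:
  assumes "a \<in> Vq_coeff_space arveson_weight"
  shows "Vq_B Omega_A u (Vq_series Omega_A a) = Vq_series Omega_A (Vq_backward arveson_weight u a)"
proof -
  have ratio: "arveson_weight (\<alpha> + axis u 1) / arveson_weight \<alpha> = real (Suc (\<alpha> $ u)) / real (Suc (midx_abs \<alpha>))" for \<alpha>
    using arveson_weight_pos[of \<alpha>] unfolding arveson_weight_add_axis by simp
  have "(\<Sum>\<^sub>\<infinity>\<alpha>. (if \<alpha> $ u = 0 then 0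
        else (real (\<alpha> $ u) / real (midx_abs \<alpha>)) *\<^sub>R Vq_mu_pow (\<alpha> - axis u 1) x) * a \<alpha>) =
      (\<Sum>\<^sub>\<infinity>\<alpha>. Vq_mu_pow \<alpha> x * Vq_backward arveson_weight u a \<alpha>)" for x
    by (subst infsum_shift[of u, symmetric])
      (auto simp: Vq_backward_def ratio midx_abs_add_axis add.commute)
  then show ?thesis
    by (simp add: Vq_B_def Vq_op_def arveson.coeff_series assms) (simp add: Vq_series_def)
qed

lemma arveson_B_bounded: "Vq_bounded_op arveson_weight Omega_A (Vq_B Omega_A u)"
  by (rule arveson.bounded_opI[where S = "Vq_backward arveson_weight u" and K = 1, OF arveson_B_series])
    (use arveson.backward_bounded[OF arveson_weight_add_axis_le] in
      \<open>auto simp: Vq_backward_def algebra_simps\<close>)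

lemma arveson_M_adj:
  assumes "f \<in> arveson_space"
  shows "Vq_M_adj arveson_weight Omega_A u f = Vq_B Omega_A u f"
  using assms by (auto simp: Vq_space_def arveson.M_adj_series arveson_M_bounded arveson_B_series)

section \<open>Uniqueness of the Arveson space\<close>

lemma zero_ext_series: "\<Omega> \<subseteq> \<Omega>' \<Longrightarrow> zero_ext \<Omega> (Vq_series \<Omega>' a) = Vq_series \<Omega> a"
  by (auto simp: Vq_series_def zero_ext_def fun_eq_iff)

text \<open>The recurrence forces the Arveson weight. Kernels at points of \<Omega> have finite
  norm, which is the condition defining \<open>Omega_A\<close>. Both spaces then have the same
  coefficient sequences, and restriction to \<Omega> keeps coefficients and hence inner
  products.\<close>

lemma arveson_space_unique:
  assumes rk: "Vq_rkhs c \<Omega>" and bd: "\<And>u. Vq_bounded_op c \<Omega> (Vq_M \<Omega> u)"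
    and id: "Vq_structural_identity c \<Omega>"
  shows "\<Omega> \<subseteq> Omega_A" "Vq_space c \<Omega> = zero_ext \<Omega> ` arveson_space"
    "f \<in> arveson_space \<Longrightarrow> g \<in> arveson_space \<Longrightarrow>
      Vq_inner c \<Omega> (zero_ext \<Omega> f) (zero_ext \<Omega> g) = arveson_inner f g"
proof -
  interpret Vq_weighted_space c \<Omega> by (rule Vq_rkhs_weighted_space[OF rk])
  have c: "c = arveson_weight"
    using structural_identity_iff[OF bd] id by (intro arveson_weight_unique) auto
  show sub: "\<Omega> \<subseteq> Omega_A"
    using rk Vq_rkhs_summable[OF rk] c by (auto simp: Omega_A_iff Vq_rkhs_def)
  show "Vq_space c \<Omega> = zero_ext \<Omega> ` arveson_space"
    by (simp add: Vq_space_def c image_image zero_ext_series sub)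
  show "Vq_inner c \<Omega> (zero_ext \<Omega> f) (zero_ext \<Omega> g) = arveson_inner f g"
    if "f \<in> arveson_space" "g \<in> arveson_space"
    using that inner_series
    by (auto simp: Vq_space_def zero_ext_series sub arveson.inner_series c)
qed

theorem theorem6p4:
  shows "(Vq_rkhs arveson_weight Omega_A \<and>
          (\<forall>u. Vq_bounded_op arveson_weight Omega_A (Vq_M Omega_A u)) \<and>
          Vq_structural_identity arveson_weight Omega_A) \<and>
         (\<forall>c \<Omega>. Vq_rkhs c \<Omega> \<and> (\<forall>u. Vq_bounded_op c \<Omega> (Vq_M \<Omega> u)) \<and>
            Vq_structural_identity c \<Omega> \<longrightarrow>
            \<Omega> \<subseteq> Omega_A \<and>
            Vq_space c \<Omega> = zero_ext \<Omega> ` arveson_space \<and>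
            (\<exists>k>0. \<forall>f\<in>arveson_space. \<forall>g\<in>arveson_space.
               Vq_inner c \<Omega> (zero_ext \<Omega> f) (zero_ext \<Omega> g) = k *\<^sub>R arveson_inner f g)) \<and>
         (\<forall>u. Vq_bounded_op arveson_weight Omega_A (Vq_B Omega_A u) \<and>
            (\<forall>f\<in>arveson_space. Vq_M_adj arveson_weight Omega_A u f = Vq_B Omega_A u f))"
proof (intro conjI allI impI)
  fix c \<Omega>
  assume "Vq_rkhs c \<Omega> \<and> (\<forall>u. Vq_bounded_op c \<Omega> (Vq_M \<Omega> u)) \<and> Vq_structural_identity c \<Omega>"
  then have *: "Vq_rkhs c \<Omega>" "\<And>u. Vq_bounded_op c \<Omega> (Vq_M \<Omega> u)" "Vq_structural_identity c \<Omega>"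
    by auto
  show "\<Omega> \<subseteq> Omega_A" "Vq_space c \<Omega> = zero_ext \<Omega> ` arveson_space"
    by (rule arveson_space_unique[OF *])+
  \<comment> \<open>The witness is 1, because the identity at \<alpha> = 0 fixes c_0 = 1.\<close>
  show "\<exists>k>0. \<forall>f\<in>arveson_space. \<forall>g\<in>arveson_space.
      Vq_inner c \<Omega> (zero_ext \<Omega> f) (zero_ext \<Omega> g) = k *\<^sub>R arveson_inner f g"
    using arveson_space_unique(3)[OF *] by (intro exI[of _ 1]) simp
qed (simp_all add: arveson_rkhs arveson_M_bounded arveson_structural_identity
    arveson_B_bounded arveson_M_adj)

end
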